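(* Let $n$ be a positive integer and $p$ a prime with $p\le n$, and let $\mathbf{k}=\mathbb{F}_p$. Let the symmetric group $S_n$ act on $R=\mathbf{k}[x_1,\ldots,x_n]$ by permuting the variables, so that $R^{S_n}=\mathbf{k}[e_1,\ldots,e_n]$ where $e_i$ is the $i$-th elementary symmetric polynomial in $x_1,\dots,x_n$. Write $n=qp+r$ with integers $q\ge 0$ and $0\le r<p$. Let $I_n=\operatorname{Im}(\mathrm{Tr}^{S_n})\subseteq R^{S_n}$ be the image of the transfer map $\mathrm{Tr}^{S_n}:R\to R^{S_n}$, $f\mapsto\sum_{g\in S_n}g\cdot f$. Define polynomials $f_0,\dots,f_{p-1}\in R^{S_n}[t]$ by $$f_k=\begin{cases} t^q+e_pt^{q-1}+e_{2p}t^{q-2}+\cdots+e_{(q-1)p}t+e_{qp} & \text{if } k=0,\\ e_kt^q+e_{p+k}t^{q-1}+\cdots+e_{qp+k} & \text{if } r\ge 1 \text{ and } 1\le k\le r,\\ e_kt^{q-1}+e_{p+k}t^{q-2}+\cdots+e_{(q-1)p+k} & \text{if } r<k\le p-1.\end{cases}$$ Then $I_n=\langle f_0,f_1,\ldots,f_{p-1}\rangle\cap R^{S_n}$, where the ideal $\langle f_0,\dots,f_{p-1}\rangle$ is taken in $R^{S_n}[t]$.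
   Context: $t$ is a new indeterminate; $R^{S_n}$ is regarded as the subring of constants in $R^{S_n}[t]$. *)

theory Defs
  imports "HOL-Library.Poly_Mapping" "HOL-Computational_Algebra.Polynomial"
    "HOL-Computational_Algebra.Primes" "HOL-Combinatorics.Permutations"
begin

text \<open>Multivariate polynomials over 'a in variables indexed by nat:
  a monomial is a finitely supported exponent vector, a polynomial a finitely
  supported map from monomials to coefficients. The variables x_1,...,x_n of the
  paper are the variables with indices 0,...,n-1.\<close>

type_synonym 'a mpol = "(nat \<Rightarrow>\<^sub>0 nat) \<Rightarrow>\<^sub>0 'a"

definition polyring :: "nat \<Rightarrow> 'a::comm_ring_1 mpol set" where
  "polyring n = {f. \<forall>m\<in>Poly_Mapping.keys f. Poly_Mapping.keys m \<subseteq> {..<n}}"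

definition perm_act :: "(nat \<Rightarrow> nat) \<Rightarrow> 'a::comm_ring_1 mpol \<Rightarrow> 'a mpol" where
  "perm_act \<sigma> f = (\<Sum>m\<in>Poly_Mapping.keys f.
      Poly_Mapping.single (\<Sum>i\<in>Poly_Mapping.keys m. Poly_Mapping.single (\<sigma> i) (Poly_Mapping.lookup m i)) (Poly_Mapping.lookup f m))"

definition sym_polys :: "nat \<Rightarrow> 'a::comm_ring_1 mpol set" where
  "sym_polys n = {f \<in> polyring n. \<forall>\<sigma>. \<sigma> permutes {..<n} \<longrightarrow> perm_act \<sigma> f = f}"

definition transfer :: "nat \<Rightarrow> 'a::comm_ring_1 mpol \<Rightarrow> 'a mpol" where
  "transfer n f = (\<Sum>\<sigma>\<in>{\<sigma>. \<sigma> permutes {..<n}}. perm_act \<sigma> f)"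

definition transfer_image :: "nat \<Rightarrow> 'a::comm_ring_1 mpol set" where
  "transfer_image n = transfer n ` polyring n"

definition elem_sym :: "nat \<Rightarrow> nat \<Rightarrow> 'a::comm_ring_1 mpol" where
  "elem_sym n i = (\<Sum>S\<in>{S. S \<subseteq> {..<n} \<and> card S = i}.
      Poly_Mapping.single (\<Sum>j\<in>S. Poly_Mapping.single j 1) 1)"

definition fgen :: "nat \<Rightarrow> nat \<Rightarrow> nat \<Rightarrow> 'a::comm_ring_1 mpol poly" where
  "fgen n p k = (let q = n div p; r = n mod p in
     if k = 0 then monom 1 q + (\<Sum>j\<in>{1..q}. monom (elem_sym n (j * p)) (q - j))
     else if k \<le> r then (\<Sum>j\<in>{..q}. monom (elem_sym n (j * p + k)) (q - j))
     else (\<Sum>j\<in>{..<q}. monom (elem_sym n (j * p + k)) (q - 1 - j)))"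

end

theory Submission
  imports Defs
begin

text \<open>Let \<open>\<rho>\<close> be the substitution that makes \<open>x\<^sub>1, \<dots>, x\<^sub>p\<close> equal to one variable \<open>y\<close>. Both sides are
  the kernel of \<open>\<rho>\<close> on symmetric polynomials.

  The transfer is spanned by the monomial symmetric functions all of whose exponents have
  multiplicity less than \<open>p\<close>, because the other stabilizers have order divisible by \<open>p\<close>. The map \<open>\<rho>\<close>
  kills them, as \<open>S\<^sub>p\<close> permutes the summands freely; on the monomials whose first \<open>p\<close> exponents agree
  it is injective, and all other monomials of an \<open>S\<^sub>p\<close>-invariant cancel.

  For the ideal, put \<open>P = \<Prod>\<^sub>i (z + x\<^sub>i)\<close>. The \<open>f\<^sub>k\<close> are the coefficients of the remainder of \<open>P\<close> modulo
  \<open>z\<^sup>p - t\<close>. Modulo the \<open>f\<^sub>k\<close> the elementary symmetric polynomials are therefore expressed by \<open>t\<close> and the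
  coefficients of the quotient. The substitution \<open>\<rho>\<close>, extended by \<open>t \<mapsto> -y\<^sup>p\<close>, turns \<open>P\<close> into
  \<open>(z\<^sup>p + y\<^sup>p) \<Prod>\<^bsub>i>p\<^esub> (z + x\<^sub>i)\<close>: it kills the \<open>f\<^sub>k\<close> and sends \<open>t\<close> and those coefficients to
  algebraically independent elements.\<close>

section \<open>Evaluation homomorphisms\<close>

text \<open>Unital ring homomorphisms as a predicate, so that permutation actions, substitutions,
  evaluations and embeddings of constants share the same rules.\<close>

definition rhom :: "('b::comm_ring_1 \<Rightarrow> 'c::comm_ring_1) \<Rightarrow> bool" where
  "rhom h \<longleftrightarrow> h 1 = 1 \<and> (\<forall>x y. h (x + y) = h x + h y) \<and> (\<forall>x y. h (x * y) = h x * h y)"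

lemma rhomI:
  assumes "h 1 = 1" "\<And>x y. h (x + y) = h x + h y" "\<And>x y. h (x * y) = h x * h y"
  shows "rhom h"
  using assms by (simp add: rhom_def)

lemma rhom_1: "rhom h \<Longrightarrow> h 1 = 1"
  and rhom_add: "rhom h \<Longrightarrow> h (x + y) = h x + h y"
  and rhom_mult: "rhom h \<Longrightarrow> h (x * y) = h x * h y"
  by (simp_all add: rhom_def)

lemma rhom_0: "rhom h \<Longrightarrow> h 0 = 0"
  using rhom_add[of h 0 0] by simp

lemma rhom_uminus: "rhom h \<Longrightarrow> h (- x) = - h x"
  using rhom_add[of h x "- x"] rhom_0[of h] by (simp add: minus_unique)

lemma rhom_diff: "rhom h \<Longrightarrow> h (x - y) = h x - h y"
  using rhom_add[of h x "- y"] rhom_uminus[of h y] by simp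

lemma rhom_sum: "rhom h \<Longrightarrow> h (sum f A) = (\<Sum>a\<in>A. h (f a))"
  by (induction A rule: infinite_finite_induct) (auto simp: rhom_0 rhom_add)

lemma rhom_prod: "rhom h \<Longrightarrow> h (prod f A) = (\<Prod>a\<in>A. h (f a))"
  by (induction A rule: infinite_finite_induct) (auto simp: rhom_1 rhom_mult)

lemma rhom_power: "rhom h \<Longrightarrow> h (x ^ k) = h x ^ k"
  by (induction k) (auto simp: rhom_1 rhom_mult)

lemma rhom_comp: "rhom g \<Longrightarrow> rhom h \<Longrightarrow> rhom (g \<circ> h)"
  by (simp add: rhom_def)

abbreviation const_mpol :: "'a::comm_ring_1 \<Rightarrow> 'a mpol" where
  "const_mpol \<equiv> Poly_Mapping.single 0"

definition var :: "nat \<Rightarrow> 'a::comm_ring_1 mpol" where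
  "var i = Poly_Mapping.single (Poly_Mapping.single i 1) 1"

lemma rhom_const: "rhom const_mpol"
  by (rule rhomI) (auto simp: single_add mult_single)

lemma rhom_pCons: "rhom (\<lambda>c. [:c:])"
  by (rule rhomI) auto

definition mon_val :: "(nat \<Rightarrow> 'b::comm_ring_1) \<Rightarrow> (nat \<Rightarrow>\<^sub>0 nat) \<Rightarrow> 'b" where
  "mon_val v m = (\<Prod>i\<in>Poly_Mapping.keys m. v i ^ Poly_Mapping.lookup m i)"

text \<open>Evaluation as in the universal property of polynomial rings: coefficients go through
  \<open>\<kappa>\<close> and variable \<open>i\<close> goes to \<open>v i\<close>.\<close>

definition ins :: "('a::comm_ring_1 \<Rightarrow> 'b::comm_ring_1) \<Rightarrow> (nat \<Rightarrow> 'b) \<Rightarrow> 'a mpol \<Rightarrow> 'b" where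
  "ins \<kappa> v f = (\<Sum>m\<in>Poly_Mapping.keys f. \<kappa> (Poly_Mapping.lookup f m) * mon_val v m)"

lemma mon_val_superset:
  assumes "finite S" "Poly_Mapping.keys m \<subseteq> S"
  shows "mon_val v m = (\<Prod>i\<in>S. v i ^ Poly_Mapping.lookup m i)"
  unfolding mon_val_def
  by (rule prod.mono_neutral_left) (use assms in \<open>auto simp: in_keys_iff\<close>)

lemma mon_val_0 [simp]: "mon_val v 0 = 1"
  by (simp add: mon_val_def)

lemma mon_val_add: "mon_val v (m + m') = mon_val v m * mon_val v m'"
proof -
  let ?S = "Poly_Mapping.keys m \<union> Poly_Mapping.keys m'"
  have "mon_val v (m + m') = (\<Prod>i\<in>?S. v i ^ Poly_Mapping.lookup (m + m') i)"
    by (rule mon_val_superset) (auto simp: in_keys_iff lookup_add)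
  also have "\<dots> = (\<Prod>i\<in>?S. v i ^ Poly_Mapping.lookup m i) * (\<Prod>i\<in>?S. v i ^ Poly_Mapping.lookup m' i)"
    by (simp add: lookup_add power_add prod.distrib)
  also have "\<dots> = mon_val v m * mon_val v m'"
    by (subst (1 2) mon_val_superset[of ?S]) auto
  finally show ?thesis .
qed

lemma mon_val_single [simp]: "mon_val v (Poly_Mapping.single i k) = v i ^ k"
  by (cases "k = 0") (auto simp: mon_val_def)

lemma ins_superset:
  assumes "rhom \<kappa>" "finite S" "Poly_Mapping.keys f \<subseteq> S"
  shows "ins \<kappa> v f = (\<Sum>m\<in>S. \<kappa> (Poly_Mapping.lookup f m) * mon_val v m)"
  unfolding ins_def
  by (rule sum.mono_neutral_left) (use assms in \<open>auto simp: in_keys_iff rhom_0\<close>)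

lemma ins_single: "rhom \<kappa> \<Longrightarrow> ins \<kappa> v (Poly_Mapping.single m a) = \<kappa> a * mon_val v m"
  by (cases "a = 0") (auto simp: ins_def rhom_0)

lemma ins_var: "rhom \<kappa> \<Longrightarrow> ins \<kappa> v (var i) = v i"
  by (simp add: var_def ins_single rhom_1)

lemma ins_const: "rhom \<kappa> \<Longrightarrow> ins \<kappa> v (const_mpol a) = \<kappa> a"
  by (simp add: ins_single)

lemma ins_0: "ins \<kappa> v 0 = 0"
  by (simp add: ins_def)

lemma ins_add:
  assumes "rhom \<kappa>"
  shows "ins \<kappa> v (f + g) = ins \<kappa> v f + ins \<kappa> v g"
proof -
  let ?S = "Poly_Mapping.keys f \<union> Poly_Mapping.keys g"
  have "ins \<kappa> v (f + g) = (\<Sum>m\<in>?S. \<kappa> (Poly_Mapping.lookup (f + g) m) * mon_val v m)"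
    by (rule ins_superset[OF assms]) (auto simp: in_keys_iff lookup_add)
  also have "\<dots> = (\<Sum>m\<in>?S. \<kappa> (Poly_Mapping.lookup f m) * mon_val v m)
      + (\<Sum>m\<in>?S. \<kappa> (Poly_Mapping.lookup g m) * mon_val v m)"
    by (simp add: lookup_add rhom_add[OF assms] ring_distribs sum.distrib)
  also have "\<dots> = ins \<kappa> v f + ins \<kappa> v g"
    by (subst (1 2) ins_superset[OF assms, of ?S]) auto
  finally show ?thesis .
qed

lemma ins_sum: "rhom \<kappa> \<Longrightarrow> ins \<kappa> v (sum f A) = (\<Sum>a\<in>A. ins \<kappa> v (f a))"
  by (induction A rule: infinite_finite_induct) (auto simp: ins_add ins_0)

lemma sum_singles:
  assumes "finite S" "Poly_Mapping.keys f \<subseteq> S"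
  shows "f = (\<Sum>m\<in>S. Poly_Mapping.single m (Poly_Mapping.lookup f m))"
proof (rule poly_mapping_eqI)
  fix k
  show "Poly_Mapping.lookup f k
      = Poly_Mapping.lookup (\<Sum>m\<in>S. Poly_Mapping.single m (Poly_Mapping.lookup f m)) k"
    using assms
    by (auto simp: lookup_sum lookup_single when_def sum.delta in_keys_iff)
qed

lemma mult_eq_sum_singles:
  fixes f g :: "'a::comm_ring_1 mpol"
  shows "f * g = (\<Sum>m\<in>Poly_Mapping.keys f. \<Sum>m'\<in>Poly_Mapping.keys g.
    Poly_Mapping.single (m + m') (Poly_Mapping.lookup f m * Poly_Mapping.lookup g m'))"
  by (subst (1) sum_singles[of "Poly_Mapping.keys f" f], simp, simp,
      subst (1) sum_singles[of "Poly_Mapping.keys g" g])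
     (simp_all add: sum_product mult_single)

lemma ins_mult:
  assumes "rhom \<kappa>"
  shows "ins \<kappa> v (f * g) = ins \<kappa> v f * ins \<kappa> v g"
proof -
  let ?F = "Poly_Mapping.keys f" and ?G = "Poly_Mapping.keys g"
  have "ins \<kappa> v (f * g) = (\<Sum>m\<in>?F. \<Sum>m'\<in>?G. \<kappa> (Poly_Mapping.lookup f m * Poly_Mapping.lookup g m')
      * mon_val v (m + m'))"
    by (simp add: mult_eq_sum_singles[of f g] ins_sum[OF assms] ins_single[OF assms])
  also have "\<dots> = ins \<kappa> v f * ins \<kappa> v g"
    by (simp add: ins_def sum_product rhom_mult[OF assms] mon_val_add mult_ac)
  finally show ?thesis .
qed

lemma rhom_ins: "rhom \<kappa> \<Longrightarrow> rhom (ins \<kappa> v)"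
  by (rule rhomI) (auto simp: ins_add ins_mult ins_const[of \<kappa> v 1, simplified] rhom_1)

text \<open>Takes the place of the uniqueness half of the universal property: composites of
  substitutions are computed from the images of constants and variables alone.\<close>

lemma rhom_of_ins:
  assumes "rhom h"
  shows "h (ins \<kappa> v f) = ins (\<lambda>a. h (\<kappa> a)) (\<lambda>i. h (v i)) f"
  by (simp add: ins_def mon_val_def rhom_sum[OF assms] rhom_mult[OF assms] rhom_prod[OF assms]
      rhom_power[OF assms])

section \<open>Permuting the variables, on monomials and on coefficients\<close>

text \<open>For a non-injective \<open>\<sigma>\<close> the exponents of identified variables add
  up, so the same map also describes substitutions that merge variables.\<close>

definition map_mon :: "(nat \<Rightarrow> nat) \<Rightarrow> (nat \<Rightarrow>\<^sub>0 nat) \<Rightarrow> (nat \<Rightarrow>\<^sub>0 nat)" where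
  "map_mon \<sigma> m = (\<Sum>i\<in>Poly_Mapping.keys m. Poly_Mapping.single (\<sigma> i) (Poly_Mapping.lookup m i))"

lemma var_power: "var i ^ k = Poly_Mapping.single (Poly_Mapping.single i k) 1"
  by (induction k) (auto simp: var_def mult_single simp flip: single_add)

lemma prod_single_1:
  "(\<Prod>i\<in>A. Poly_Mapping.single (m i) (1::'a::comm_ring_1)) = Poly_Mapping.single (\<Sum>i\<in>A. m i) 1"
  for m :: "'b \<Rightarrow> (nat \<Rightarrow>\<^sub>0 nat)"
  by (induction A rule: infinite_finite_induct) (auto simp: mult_single)

lemma mon_val_var: "mon_val (\<lambda>i. var (\<sigma> i)) m = Poly_Mapping.single (map_mon \<sigma> m) 1"
  by (simp add: mon_val_def map_mon_def var_power prod_single_1)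

lemma ins_const_var:
  "ins const_mpol (\<lambda>i. var (\<sigma> i)) f
    = (\<Sum>m\<in>Poly_Mapping.keys f. Poly_Mapping.single (map_mon \<sigma> m) (Poly_Mapping.lookup f m))"
  by (simp add: ins_def mon_val_var mult_single)

lemma perm_act_eq_ins: "perm_act \<sigma> = ins const_mpol (\<lambda>i. var (\<sigma> i))"
  by (simp add: fun_eq_iff ins_const_var perm_act_def map_mon_def)

lemma rhom_perm_act: "rhom (perm_act \<sigma>)"
  by (simp add: perm_act_eq_ins rhom_ins rhom_const)

lemma perm_act_var: "perm_act \<sigma> (var i) = var (\<sigma> i)"
  by (simp add: perm_act_eq_ins ins_var rhom_const)

lemma perm_act_const: "perm_act \<sigma> (const_mpol a) = const_mpol a"
  by (simp add: perm_act_eq_ins ins_const rhom_const)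

lemma perm_act_comp: "perm_act \<tau> (perm_act \<sigma> f) = perm_act (\<tau> \<circ> \<sigma>) f"
  using rhom_of_ins[OF rhom_perm_act, of \<tau> const_mpol "\<lambda>i. var (\<sigma> i)" f]
  by (simp add: perm_act_eq_ins[of \<sigma>] perm_act_eq_ins[of "\<tau> \<circ> \<sigma>"] perm_act_var perm_act_const)

lemma lookup_map_mon:
  assumes "bij \<sigma>"
  shows "Poly_Mapping.lookup (map_mon \<sigma> m) j = Poly_Mapping.lookup m (inv \<sigma> j)"
proof -
  have eq: "\<sigma> i = j \<longleftrightarrow> i = inv \<sigma> j" for i
    using assms by (metis bij_inv_eq_iff)
  show ?thesis
    by (auto simp: map_mon_def lookup_sum lookup_single when_def eq in_keys_iff)
qed

lemma lookup_map_mon_inv: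
  assumes "bij \<sigma>"
  shows "Poly_Mapping.lookup (map_mon (inv \<sigma>) m) j = Poly_Mapping.lookup m (\<sigma> j)"
  using lookup_map_mon[of "inv \<sigma>" m j] assms by (simp add: bij_imp_bij_inv inv_inv_eq)

lemma keys_map_mon:
  assumes "\<sigma> permutes A" "Poly_Mapping.keys m \<subseteq> A"
  shows "Poly_Mapping.keys (map_mon \<sigma> m) \<subseteq> A"
proof
  fix j assume "j \<in> Poly_Mapping.keys (map_mon \<sigma> m)"
  then have "inv \<sigma> j \<in> A"
    using assms(2) by (auto simp: in_keys_iff lookup_map_mon[OF permutes_bij[OF assms(1)]])
  then show "j \<in> A"
    using permutes_in_image[OF permutes_inv[OF assms(1)]] by blast
qed

lemma map_mon_eq_iff:
  assumes "bij \<sigma>"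
  shows "map_mon \<sigma> m = m' \<longleftrightarrow> m = map_mon (inv \<sigma>) m'"
proof -
  have "map_mon \<sigma> m = m' \<longleftrightarrow> (\<forall>j. Poly_Mapping.lookup m (inv \<sigma> j) = Poly_Mapping.lookup m' j)"
    by (simp add: poly_mapping_eq_iff fun_eq_iff lookup_map_mon[OF assms])
  also have "\<dots> \<longleftrightarrow> (\<forall>j. Poly_Mapping.lookup m j = Poly_Mapping.lookup m' (\<sigma> j))"
    using assms by (metis bij_inv_eq_iff)
  also have "\<dots> \<longleftrightarrow> m = map_mon (inv \<sigma>) m'"
    by (simp add: poly_mapping_eq_iff fun_eq_iff lookup_map_mon_inv[OF assms])
  finally show ?thesis .
qed

text \<open>Turns invariance under \<open>\<sigma>\<close> into equality of coefficients along
  orbits of monomials, the form in which symmetry is used below.\<close>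

lemma lookup_perm_act:
  assumes "bij \<sigma>"
  shows "Poly_Mapping.lookup (perm_act \<sigma> f) m = Poly_Mapping.lookup f (map_mon (inv \<sigma>) m)"
  by (auto simp: perm_act_eq_ins ins_const_var lookup_sum lookup_single when_def
      map_mon_eq_iff[OF assms] in_keys_iff)

section \<open>Subrings, polynomials in n variables, symmetric polynomials\<close>

definition subring :: "'b::comm_ring_1 set \<Rightarrow> bool" where
  "subring A \<longleftrightarrow> 1 \<in> A \<and> (\<forall>x\<in>A. \<forall>y\<in>A. x - y \<in> A \<and> x * y \<in> A)"

lemma subring_1: "subring A \<Longrightarrow> 1 \<in> A"
  and subring_diff: "subring A \<Longrightarrow> x \<in> A \<Longrightarrow> y \<in> A \<Longrightarrow> x - y \<in> A"
  and subring_mult: "subring A \<Longrightarrow> x \<in> A \<Longrightarrow> y \<in> A \<Longrightarrow> x * y \<in> A"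
  by (simp_all add: subring_def)

lemma subring_0: "subring A \<Longrightarrow> 0 \<in> A"
  using subring_diff[of A 1 1] subring_1[of A] by simp

lemma subring_uminus: "subring A \<Longrightarrow> x \<in> A \<Longrightarrow> - x \<in> A"
  using subring_diff[of A 0 x] subring_0[of A] by simp

lemma subring_add: "subring A \<Longrightarrow> x \<in> A \<Longrightarrow> y \<in> A \<Longrightarrow> x + y \<in> A"
  using subring_diff[of A x "- y"] subring_uminus[of A y] by simp

lemma subring_sum: "subring A \<Longrightarrow> (\<And>i. i \<in> I \<Longrightarrow> f i \<in> A) \<Longrightarrow> sum f I \<in> A"
  by (induction I rule: infinite_finite_induct) (auto simp: subring_0 subring_add)

lemma subring_prod: "subring A \<Longrightarrow> (\<And>i. i \<in> I \<Longrightarrow> f i \<in> A) \<Longrightarrow> prod f I \<in> A"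
  by (induction I rule: infinite_finite_induct) (auto simp: subring_1 subring_mult)

lemma subring_power: "subring A \<Longrightarrow> x \<in> A \<Longrightarrow> x ^ k \<in> A"
  by (induction k) (auto simp: subring_1 subring_mult)

lemma subring_mon_val: "subring A \<Longrightarrow> (\<And>i. v i \<in> A) \<Longrightarrow> mon_val v m \<in> A"
  unfolding mon_val_def by (intro subring_prod subring_power) auto

lemma subring_ins:
  "subring A \<Longrightarrow> (\<And>a. \<kappa> a \<in> A) \<Longrightarrow> (\<And>i. v i \<in> A) \<Longrightarrow> ins \<kappa> v f \<in> A"
  unfolding ins_def by (intro subring_sum subring_mult subring_mon_val) auto

lemma polyring_single: "Poly_Mapping.keys m \<subseteq> {..<n} \<Longrightarrow> Poly_Mapping.single m a \<in> polyring n"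
  by (auto simp: polyring_def)

lemma subring_polyring: "subring (polyring n)"
  unfolding subring_def
proof (intro conjI ballI)
  show "1 \<in> polyring n" by (auto simp: polyring_def)
  fix f g :: "'a mpol" assume "f \<in> polyring n" "g \<in> polyring n"
  then have f: "\<And>m. m \<in> Poly_Mapping.keys f \<Longrightarrow> Poly_Mapping.keys m \<subseteq> {..<n}"
    and g: "\<And>m. m \<in> Poly_Mapping.keys g \<Longrightarrow> Poly_Mapping.keys m \<subseteq> {..<n}"
    by (auto simp: polyring_def)
  have "m \<in> Poly_Mapping.keys f \<or> m \<in> Poly_Mapping.keys g" if "m \<in> Poly_Mapping.keys (f - g)" for m
    using that by (auto simp: in_keys_iff lookup_minus)
  then show "f - g \<in> polyring n"
    using f g unfolding polyring_def by blast
  have "Poly_Mapping.keys m \<subseteq> {..<n}" if m: "m \<in> Poly_Mapping.keys (f * g)" for m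
  proof -
    obtain a b where "m = a + b" "a \<in> Poly_Mapping.keys f" "b \<in> Poly_Mapping.keys g"
      using m keys_mult[of f g] by blast
    then show ?thesis
      using f[of a] g[of b] Poly_Mapping.keys_add[of a b] by blast
  qed
  then show "f * g \<in> polyring n" by (simp add: polyring_def)
qed

lemma subring_sym_polys: "subring (sym_polys n)"
  using subring_polyring[of n] unfolding subring_def sym_polys_def
  by (auto simp: rhom_1[OF rhom_perm_act] rhom_diff[OF rhom_perm_act] rhom_mult[OF rhom_perm_act])

lemma const_in_sym_polys: "const_mpol a \<in> sym_polys n"
  by (auto simp: sym_polys_def perm_act_const polyring_single)

lemma perm_act_polyring:
  assumes "\<sigma> permutes {..<n}" "f \<in> polyring n"
  shows "perm_act \<sigma> f \<in> polyring n"
proof -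
  have "perm_act \<sigma> f = (\<Sum>m\<in>Poly_Mapping.keys f. Poly_Mapping.single (map_mon \<sigma> m) (Poly_Mapping.lookup f m))"
    by (simp add: perm_act_eq_ins ins_const_var)
  also have "\<dots> \<in> polyring n"
    by (intro subring_sum[OF subring_polyring] polyring_single keys_map_mon[OF assms(1)])
       (use assms(2) in \<open>auto simp: polyring_def\<close>)
  finally show ?thesis .
qed

section \<open>The transfer image as the kernel of a restriction map\<close>

text \<open>The index set is a parameter because the argument uses the transfer for the full group
  on \<open>{..<n}\<close> and for its subgroup on \<open>{..<p}\<close>.\<close>

definition transfer_on :: "nat set \<Rightarrow> 'a::comm_ring_1 mpol \<Rightarrow> 'a mpol" where
  "transfer_on A f = (\<Sum>\<sigma>\<in>{\<sigma>. \<sigma> permutes A}. perm_act \<sigma> f)"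

lemma transfer_eq: "transfer n = transfer_on {..<n}"
  by (simp add: fun_eq_iff transfer_def transfer_on_def)

lemma transfer_on_add: "transfer_on A (f + g) = transfer_on A f + transfer_on A g"
  by (simp add: transfer_on_def rhom_add[OF rhom_perm_act] sum.distrib)

lemma transfer_on_0: "transfer_on A 0 = 0"
  by (simp add: transfer_on_def rhom_0[OF rhom_perm_act])

lemma perm_act_transfer_on:
  assumes "\<tau> permutes A"
  shows "perm_act \<tau> (transfer_on A f) = transfer_on A f"
  using setum_permutations_compose_left[OF assms, of "\<lambda>\<sigma>. perm_act \<sigma> f"]
  unfolding transfer_on_def rhom_sum[OF rhom_perm_act] perm_act_comp by simp

lemma transfer_in_sym_polys:
  assumes "f \<in> polyring n"
  shows "transfer n f \<in> sym_polys n"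
proof -
  have "transfer n f \<in> polyring n"
    unfolding transfer_def using assms
    by (intro subring_sum[OF subring_polyring] perm_act_polyring) auto
  then show ?thesis by (simp add: sym_polys_def transfer_eq perm_act_transfer_on)
qed

section \<open>Monomials with stabilizer of order prime to p\<close>

text \<open>The stabilizer is a product of symmetric groups on the level sets of \<open>m\<close>,
  each of size less than p. Adding a point \<open>a\<close> multiplies its order by the size of the
  level set of \<open>a\<close>, a positive number below p.\<close>

lemma prime_not_dvd_card_level_stabilizer:
  assumes "prime p" "finite A" "\<And>a. card {i \<in> A. m i = a} < p"
  shows "\<not> p dvd card {\<sigma>. \<sigma> permutes A \<and> (\<forall>i\<in>A. m (\<sigma> i) = m i)}"
  using assms(2,3)
proof (induction A rule: finite_induct)
  case empty
  then show ?case using prime_gt_1_nat[OF assms(1)] by (simp add: permutes_empty)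
next
  case (insert a A)
  let ?St = "\<lambda>A. {\<sigma>. \<sigma> permutes A \<and> (\<forall>i\<in>A. m (\<sigma> i) = m i)}"
  let ?B = "{b \<in> insert a A. m b = m a}"
  let ?h = "\<lambda>(b, \<sigma>). transpose a b \<circ> \<sigma>"
  have fix_a: "\<sigma> a = a" if "\<sigma> permutes A" for \<sigma>
    using that insert.hyps(2) by (simp add: permutes_not_in)
  \<comment> \<open>Coset decomposition: split off the transposition that carries \<open>a\<close>
    to its image \<open>b\<close>. Since \<open>m b = m a\<close>, this transposition preserves
    levels, and what remains fixes \<open>a\<close>.\<close>
  have "?St (insert a A) = ?h ` (?B \<times> ?St A)"
  proof (intro equalityI subsetI)
    fix \<sigma> assume "\<sigma> \<in> ?St (insert a A)"
    then have \<sigma>: "\<sigma> permutes insert a A" "\<And>i. i \<in> insert a A \<Longrightarrow> m (\<sigma> i) = m i" by auto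
    have "\<sigma> \<in> (\<lambda>(b, \<tau>). transpose a b \<circ> \<tau>) ` {(b, \<tau>). b \<in> insert a A \<and> \<tau> \<in> {\<tau>. \<tau> permutes A}}"
      unfolding permutes_insert[of a A, symmetric] using \<sigma>(1) by simp
    then obtain b \<tau> where b: "b \<in> insert a A" "\<tau> permutes A" "\<sigma> = transpose a b \<circ> \<tau>"
      by auto
    then have "\<sigma> a = b" using fix_a[OF b(2)] by simp
    then have mb: "m b = m a" using \<sigma>(2)[of a] by simp
    have "m (\<tau> i) = m i" if "i \<in> A" for i
      using \<sigma>(2)[of i] that mb b(3) by (auto simp: transpose_def split: if_splits)
    then show "\<sigma> \<in> ?h ` (?B \<times> ?St A)" using b mb by force
  next
    fix \<sigma> assume "\<sigma> \<in> ?h ` (?B \<times> ?St A)"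
    then obtain b \<tau> where b: "b \<in> insert a A" "m b = m a" "\<tau> permutes A"
        "\<And>i. i \<in> A \<Longrightarrow> m (\<tau> i) = m i" and \<sigma>: "\<sigma> = transpose a b \<circ> \<tau>" by auto
    have "\<sigma> permutes insert a A" unfolding \<sigma>
      using permutes_imp_permutes_insert[OF b(3), of a] b(1)
      by (intro permutes_compose permutes_swap_id) auto
    moreover have "m (\<sigma> i) = m i" if "i \<in> insert a A" for i
      using that b fix_a[OF b(3)] by (auto simp: \<sigma> transpose_def)
    ultimately show "\<sigma> \<in> ?St (insert a A)" by simp
  qed
  moreover have "inj_on ?h (?B \<times> ?St A)"
  proof (rule inj_onI, clarify)
    fix b \<sigma> b' \<sigma>'
    assume *: "\<sigma> permutes A" "\<sigma>' permutes A" "transpose a b \<circ> \<sigma> = transpose a b' \<circ> \<sigma>'"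
    \<comment> \<open>The second factor fixes \<open>a\<close>, so \<open>b\<close> is recovered as
      the image of \<open>a\<close> under the composite.\<close>
    have "b = (transpose a b \<circ> \<sigma>) a" "b' = (transpose a b' \<circ> \<sigma>') a"
      using fix_a[OF *(1)] fix_a[OF *(2)] by simp_all
    then have "b = b'" using *(3) by simp
    moreover from this have "\<sigma> = \<sigma>'"
      using *(3) by (auto simp: fun_eq_iff dest: transpose_eq_imp_eq)
    ultimately show "b = b' \<and> \<sigma> = \<sigma>'" by simp
  qed
  ultimately have card: "card (?St (insert a A)) = card ?B * card (?St A)"
    by (simp add: card_image card_cartesian_product)
  have "card ?B > 0" using insert.hyps(1) by (auto simp: card_gt_0_iff)
  moreover have "card ?B < p" using insert.prems by simp
  ultimately have "\<not> p dvd card ?B" by (auto dest: dvd_imp_le)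
  moreover have "card {i \<in> A. m i = c} < p" for c
    using insert.prems[of c] card_mono[of "{i \<in> insert a A. m i = c}" "{i \<in> A. m i = c}"] insert.hyps(1)
    by fastforce
  then have "\<not> p dvd card (?St A)" by (rule insert.IH)
  ultimately show ?case using card assms(1) by (simp add: prime_dvd_mult_iff)
qed

text \<open>The exponent 0 counts as a value too: fewer than p of the variables in \<open>A\<close>
  may be absent from the monomial.\<close>

definition p_regular :: "nat \<Rightarrow> nat set \<Rightarrow> (nat \<Rightarrow>\<^sub>0 nat) \<Rightarrow> bool" where
  "p_regular p A m \<longleftrightarrow> (\<forall>a. card {i \<in> A. Poly_Mapping.lookup m i = a} < p)"

lemma p_regular_map_mon:
  assumes "\<sigma> permutes A" "p_regular p A m"
  shows "p_regular p A (map_mon (inv \<sigma>) m)"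
  unfolding p_regular_def
proof
  fix a
  have "{i \<in> A. Poly_Mapping.lookup m i = a}
      = \<sigma> ` {i \<in> A. Poly_Mapping.lookup m (\<sigma> i) = a}"
    using permutes_image[OF assms(1)] by auto
  moreover have "inj_on \<sigma> B" for B
    using permutes_inj[OF assms(1)] by (rule inj_on_subset) simp
  ultimately have "card {i \<in> A. Poly_Mapping.lookup m (\<sigma> i) = a} = card {i \<in> A. Poly_Mapping.lookup m i = a}"
    by (simp add: card_image)
  then show "card {i \<in> A. Poly_Mapping.lookup (map_mon (inv \<sigma>) m) i = a} < p"
    using assms by (simp add: lookup_map_mon_inv permutes_bij p_regular_def)
qed

lemma CHAR_prime_of_nat_neq_0:
  assumes "CHAR('a::semiring_1) = p" "\<not> p dvd N"
  shows "of_nat N \<noteq> (0::'a)"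
  using assms by (simp add: of_nat_eq_0_iff_char_dvd)

text \<open>The orbit sum of a regular monomial is its transfer divided by the order of the
  stabilizer, which is invertible in characteristic p. Subtracting such orbit sums one by one
  removes all regular monomials from \<open>c\<close>. The inclusion of keys keeps \<open>f\<close>
  in the polynomial ring that contains \<open>c\<close>.\<close>

lemma invariant_decomposition:
  fixes c :: "'a::field mpol"
  assumes p: "prime p" "CHAR('a) = p" and "finite A"
    and "\<And>\<sigma>. \<sigma> permutes A \<Longrightarrow> perm_act \<sigma> c = c"
  shows "\<exists>f. Poly_Mapping.keys f \<subseteq> Poly_Mapping.keys c \<and>
    (\<forall>m. Poly_Mapping.lookup (c - transfer_on A f) m =
      (if p_regular p A m then 0 else Poly_Mapping.lookup c m))"
  using assms(4)
proof (induction "card {m \<in> Poly_Mapping.keys c. p_regular p A m}" arbitrary: c rule: less_induct)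
  case less
  show ?case
  proof (cases "\<exists>m\<in>Poly_Mapping.keys c. p_regular p A m")
    case False
    then have "Poly_Mapping.lookup c m = 0" if "p_regular p A m" for m
      using that by (auto simp: in_keys_iff)
    then show ?thesis
      by (intro exI[of _ 0]) (auto simp: transfer_on_0)
  next
    case True
    then obtain m where m: "m \<in> Poly_Mapping.keys c" "p_regular p A m" by blast
    define St where "St = {\<sigma>. \<sigma> permutes A \<and> map_mon (inv \<sigma>) m = m}"
    \<comment> \<open>In the transfer of the monomial \<open>m\<close>, the term \<open>m\<close>
      occurs once for each element of \<open>St\<close>; the division makes its coefficient that of
      \<open>c\<close>.\<close>
    define f1 where "f1 = Poly_Mapping.single m (Poly_Mapping.lookup c m / of_nat (card St))"
    have inv: "Poly_Mapping.lookup c (map_mon (inv \<sigma>) m') = Poly_Mapping.lookup c m'"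
      if "\<sigma> permutes A" for \<sigma> m'
      using lookup_perm_act[OF permutes_bij[OF that], of c m'] less.prems[OF that] by simp
    have St_eq: "St = {\<sigma>. \<sigma> permutes A \<and> (\<forall>i\<in>A. Poly_Mapping.lookup m (\<sigma> i) = Poly_Mapping.lookup m i)}"
      unfolding St_def
      by (auto simp: poly_mapping_eq_iff fun_eq_iff lookup_map_mon_inv permutes_bij)
         (metis permutes_not_in)
    have "\<not> p dvd card St"
      unfolding St_eq by (rule prime_not_dvd_card_level_stabilizer)
        (use p(1) \<open>finite A\<close> m(2) in \<open>auto simp: p_regular_def\<close>)
    then have nz: "of_nat (card St) \<noteq> (0::'a)"
      using p(2) by (simp add: CHAR_prime_of_nat_neq_0)
    have T: "Poly_Mapping.lookup (transfer_on A f1) m' =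
        (\<Sum>\<sigma>\<in>{\<sigma>. \<sigma> permutes A}. Poly_Mapping.lookup f1 (map_mon (inv \<sigma>) m'))" for m'
      by (auto simp: transfer_on_def lookup_sum lookup_perm_act permutes_bij intro: sum.cong)
    have T0: "Poly_Mapping.lookup (transfer_on A f1) m' = 0"
      if "\<And>\<sigma>. \<sigma> permutes A \<Longrightarrow> map_mon (inv \<sigma>) m' \<noteq> m" for m'
      unfolding T using that by (intro sum.neutral) (auto simp: f1_def lookup_single when_def)
    have "Poly_Mapping.lookup (transfer_on A f1) m
        = (\<Sum>\<sigma>\<in>St. Poly_Mapping.lookup c m / of_nat (card St))"
      unfolding T using finite_permutations[OF \<open>finite A\<close>]
      by (intro sum.mono_neutral_cong_right) (auto simp: f1_def lookup_single when_def St_def)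
    then have Tm: "Poly_Mapping.lookup (transfer_on A f1) m = Poly_Mapping.lookup c m"
      using nz by simp
    \<comment> \<open>The transfer of \<open>m\<close> involves only the orbit of \<open>m\<close>,
      and regularity is constant on orbits.\<close>
    have T_irr: "Poly_Mapping.lookup (transfer_on A f1) m' = 0" if m': "\<not> p_regular p A m'" for m'
    proof (rule T0)
      fix \<sigma> assume \<sigma>: "\<sigma> permutes A"
      show "map_mon (inv \<sigma>) m' \<noteq> m"
      proof
        assume "map_mon (inv \<sigma>) m' = m"
        then have "m' = map_mon (inv (inv \<sigma>)) m"
          using map_mon_eq_iff[OF permutes_bij[OF permutes_inv[OF \<sigma>]]] by blast
        then show False
          using m' p_regular_map_mon[OF permutes_inv[OF \<sigma>] m(2)] by simp
      qed
    qed
    \<comment> \<open>Invariance of \<open>c\<close> puts the whole orbit of \<open>m\<close> among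
      its monomials, so the subtraction creates no new ones.\<close>
    have T_keys: "Poly_Mapping.lookup (transfer_on A f1) m' = 0" if "m' \<notin> Poly_Mapping.keys c" for m'
      by (rule T0) (use that m(1) inv[of _ m'] in \<open>auto simp: in_keys_iff\<close>)
    define c1 where "c1 = c - transfer_on A f1"
    have keys_c1: "Poly_Mapping.keys c1 \<subseteq> Poly_Mapping.keys c - {m}"
      using T_keys Tm by (auto simp: c1_def in_keys_iff lookup_minus)
    have "card {m \<in> Poly_Mapping.keys c1. p_regular p A m} < card {m \<in> Poly_Mapping.keys c. p_regular p A m}"
      by (rule psubset_card_mono) (use keys_c1 m in auto)
    moreover have "perm_act \<sigma> c1 = c1" if "\<sigma> permutes A" for \<sigma>
      using less.prems[OF that] perm_act_transfer_on[OF that, of f1]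
      by (simp add: c1_def rhom_diff[OF rhom_perm_act])
    ultimately obtain f2 where f2: "Poly_Mapping.keys f2 \<subseteq> Poly_Mapping.keys c1"
      "\<And>m. Poly_Mapping.lookup (c1 - transfer_on A f2) m =
        (if p_regular p A m then 0 else Poly_Mapping.lookup c1 m)"
      using less.hyps[of c1] by blast
    have "Poly_Mapping.keys (f1 + f2) \<subseteq> Poly_Mapping.keys c"
      using Poly_Mapping.keys_add[of f1 f2] f2(1) keys_c1 m(1) by (auto simp: f1_def split: if_splits)
    moreover have "Poly_Mapping.lookup (c - transfer_on A (f1 + f2)) m' =
        (if p_regular p A m' then 0 else Poly_Mapping.lookup c m')" for m'
      using f2(2)[of m'] T_irr[of m']
      by (cases "p_regular p A m'") (simp_all add: transfer_on_add c1_def lookup_minus lookup_add diff_eq_eq add.commute)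
    ultimately show ?thesis by blast
  qed
qed

section \<open>The substitution that identifies the first p variables\<close>

text \<open>The common variable y is represented by \<open>var 0\<close>, so the substitution stays
  inside the same polynomial type.\<close>

definition collapse :: "nat \<Rightarrow> nat \<Rightarrow> nat" where
  "collapse p i = (if i < p then 0 else i)"

definition restr :: "nat \<Rightarrow> 'a::comm_ring_1 mpol \<Rightarrow> 'a mpol" where
  "restr p = ins const_mpol (\<lambda>i. var (collapse p i))"

lemma rhom_restr: "rhom (restr p)"
  by (simp add: restr_def rhom_ins rhom_const)

lemma restr_var: "restr p (var i) = var (collapse p i)"
  by (simp add: restr_def ins_var rhom_const)

lemma restr_const: "restr p (const_mpol a) = const_mpol a"
  by (simp add: restr_def ins_const rhom_const)

lemma restr_perm_act: "restr p (perm_act \<sigma> f) = ins const_mpol (\<lambda>i. var (collapse p (\<sigma> i))) f"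
  using rhom_of_ins[OF rhom_restr, of p const_mpol "\<lambda>i. var (\<sigma> i)" f]
  by (simp add: perm_act_eq_ins restr_var restr_const)

lemma of_nat_mpol_eq_0:
  assumes "CHAR('a::comm_ring_1) dvd k"
  shows "of_nat k = (0::'a mpol)"
  using assms by (simp add: of_nat_eq_0_iff_char_dvd[where ?'a = 'a, symmetric] flip: single_of_nat)

text \<open>The fibres of \<open>\<sigma> \<mapsto> collapse p \<circ> \<sigma>\<close> are cosets
  of the symmetric group on \<open>{..<p}\<close>: the quotient of two permutations in one fibre
  preserves \<open>collapse p\<close>, which is injective at indices from p on.\<close>

lemma collapse_permutes_eq_iff:
  assumes "0 < p" "p \<le> n" "\<sigma> permutes {..<n}" "\<sigma>' permutes {..<n}"
  shows "collapse p \<circ> \<sigma>' = collapse p \<circ> \<sigma> \<longleftrightarrow> (\<exists>\<tau>. \<tau> permutes {..<p} \<and> \<sigma>' = \<tau> \<circ> \<sigma>)"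
proof
  assume eq: "collapse p \<circ> \<sigma>' = collapse p \<circ> \<sigma>"
  define \<tau> where "\<tau> = \<sigma>' \<circ> inv \<sigma>"
  have \<tau>: "\<tau> permutes {..<n}"
    unfolding \<tau>_def by (intro permutes_compose permutes_inv assms)
  have "collapse p (\<tau> i) = collapse p i" for i
    using fun_cong[OF eq, of "inv \<sigma> i"] permutes_inverses(1)[OF assms(3)] by (simp add: \<tau>_def)
  \<comment> \<open>For \<open>i \<ge> p\<close> the value of \<open>collapse p\<close> at
    \<open>i\<close> is \<open>i\<close> itself, which is nonzero and hence is attained only at
    \<open>i\<close>.\<close>
  then have "\<tau> i = i" if "i \<notin> {..<p}" for i
    using that assms(1) by (metis collapse_def gr_implies_not0 lessThan_iff)
  then have "\<tau> permutes {..<p}"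
    using \<tau> by (auto simp: permutes_def)
  moreover have "\<sigma>' = \<tau> \<circ> \<sigma>"
    using permutes_inv_o(2)[OF assms(3)] by (simp add: \<tau>_def comp_assoc)
  ultimately show "\<exists>\<tau>. \<tau> permutes {..<p} \<and> \<sigma>' = \<tau> \<circ> \<sigma>" by blast
next
  assume "\<exists>\<tau>. \<tau> permutes {..<p} \<and> \<sigma>' = \<tau> \<circ> \<sigma>"
  then obtain \<tau> where \<tau>: "\<tau> permutes {..<p}" "\<sigma>' = \<tau> \<circ> \<sigma>" by blast
  have "collapse p (\<tau> i) = collapse p i" for i
    using permutes_in_image[OF \<tau>(1), of i] permutes_not_in[OF \<tau>(1), of i] by (auto simp: collapse_def)
  then show "collapse p \<circ> \<sigma>' = collapse p \<circ> \<sigma>" by (simp add: \<tau>(2) fun_eq_iff)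
qed

text \<open>After the substitution the summands are constant on cosets of the symmetric group on
  \<open>{..<p}\<close>. Each coset contributes \<open>fact p\<close> equal terms, and
  \<open>fact p\<close> vanishes in characteristic p.\<close>

lemma restr_transfer_on_eq_0:
  fixes f :: "'a::comm_ring_1 mpol"
  assumes "prime p" "CHAR('a) = p" "p \<le> n"
  shows "restr p (transfer_on {..<n} f) = 0"
proof -
  let ?P = "{\<sigma>. \<sigma> permutes {..<n}}"
  let ?D = "\<lambda>u. ins const_mpol (\<lambda>i. var (u i)) f"
  have p0: "0 < p" using assms(1) prime_gt_0_nat by blast
  have "restr p (transfer_on {..<n} f) = (\<Sum>\<sigma>\<in>?P. ?D (collapse p \<circ> \<sigma>))"
    by (simp add: transfer_on_def rhom_sum[OF rhom_restr] restr_perm_act)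
  also have "\<dots> = (\<Sum>u\<in>(\<lambda>\<sigma>. collapse p \<circ> \<sigma>) ` ?P. \<Sum>\<sigma>\<in>{\<sigma> \<in> ?P. collapse p \<circ> \<sigma> = u}. ?D (collapse p \<circ> \<sigma>))"
    by (rule sum.image_gen) (simp add: finite_permutations)
  also have "\<dots> = 0"
  proof (rule sum.neutral, safe)
    fix \<sigma> assume \<sigma>: "\<sigma> permutes {..<n}"
    let ?F = "{\<sigma>' \<in> ?P. collapse p \<circ> \<sigma>' = collapse p \<circ> \<sigma>}"
    have "?F = (\<lambda>\<tau>. \<tau> \<circ> \<sigma>) ` {\<tau>. \<tau> permutes {..<p}}"
    proof (intro equalityI subsetI)
      fix \<sigma>' assume "\<sigma>' \<in> ?F"
      then show "\<sigma>' \<in> (\<lambda>\<tau>. \<tau> \<circ> \<sigma>) ` {\<tau>. \<tau> permutes {..<p}}"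
        using collapse_permutes_eq_iff[OF p0 assms(3) \<sigma>, of \<sigma>'] by blast
    next
      fix \<sigma>' assume "\<sigma>' \<in> (\<lambda>\<tau>. \<tau> \<circ> \<sigma>) ` {\<tau>. \<tau> permutes {..<p}}"
      then obtain \<tau> where \<tau>: "\<tau> permutes {..<p}" "\<sigma>' = \<tau> \<circ> \<sigma>" by blast
      then have "\<tau> permutes {..<n}" using permutes_subset[of \<tau> "{..<p}"] assms(3) by simp
      then have "\<sigma>' permutes {..<n}" using \<sigma> \<tau>(2) by (simp add: permutes_compose)
      then show "\<sigma>' \<in> ?F"
        using collapse_permutes_eq_iff[OF p0 assms(3) \<sigma>, of \<sigma>'] \<tau> by blast
    qed
    moreover have "inj_on (\<lambda>\<tau>. \<tau> \<circ> \<sigma>) {\<tau>. \<tau> permutes {..<p}}"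
    proof (rule inj_onI)
      fix \<tau> \<tau>' assume "\<tau> \<circ> \<sigma> = \<tau>' \<circ> \<sigma>"
      then have "(\<tau> \<circ> \<sigma>) \<circ> inv \<sigma> = (\<tau>' \<circ> \<sigma>) \<circ> inv \<sigma>" by simp
      then show "\<tau> = \<tau>'" by (simp add: comp_assoc permutes_inv_o(1)[OF \<sigma>])
    qed
    ultimately have "card ?F = fact p"
      by (simp add: card_image card_permutations)
    then have "of_nat (card ?F) = (0::'a mpol)"
      using assms(2) p0 by (intro of_nat_mpol_eq_0) (simp add: dvd_fact)
    moreover have "(\<Sum>\<sigma>'\<in>?F. ?D (collapse p \<circ> \<sigma>')) = (\<Sum>\<sigma>'\<in>?F. ?D (collapse p \<circ> \<sigma>))"
      by (rule sum.cong) auto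
    ultimately show "(\<Sum>\<sigma>'\<in>?F. ?D (collapse p \<circ> \<sigma>')) = 0"
      by simp
  qed
  finally show ?thesis .
qed

lemma lookup_map_mon_collapse:
  assumes "0 < p"
  shows "p \<le> j \<Longrightarrow> Poly_Mapping.lookup (map_mon (collapse p) m) j = Poly_Mapping.lookup m j"
    and "Poly_Mapping.lookup (map_mon (collapse p) m) 0 = (\<Sum>i<p. Poly_Mapping.lookup m i)"
proof -
  have L: "Poly_Mapping.lookup (map_mon (collapse p) m) j
      = (\<Sum>i\<in>Poly_Mapping.keys m. if collapse p i = j then Poly_Mapping.lookup m i else 0)" for j
    by (simp add: map_mon_def lookup_sum lookup_single when_def)
  show "Poly_Mapping.lookup (map_mon (collapse p) m) j = Poly_Mapping.lookup m j" if "p \<le> j" for j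
  proof -
    have "collapse p i = j \<longleftrightarrow> i = j" for i using that assms by (auto simp: collapse_def)
    then show ?thesis unfolding L by (auto simp: in_keys_iff)
  qed
  have collapse_0: "collapse p i = 0 \<longleftrightarrow> i < p" for i using assms by (auto simp: collapse_def)
  have "Poly_Mapping.lookup (map_mon (collapse p) m) 0
      = (\<Sum>i\<in>{i \<in> Poly_Mapping.keys m. i < p}. Poly_Mapping.lookup m i)"
    unfolding L collapse_0 by (rule sum.inter_filter[symmetric]) simp
  also have "\<dots> = (\<Sum>i<p. Poly_Mapping.lookup m i)"
    by (rule sum.mono_neutral_left) (auto simp: in_keys_iff)
  finally show "Poly_Mapping.lookup (map_mon (collapse p) m) 0 = (\<Sum>i<p. Poly_Mapping.lookup m i)" .
qed

text \<open>If the first p exponents all equal \<open>a\<close>, the merged variable has exponent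
  \<open>p * a\<close>, a natural number from which \<open>a\<close> is recovered; the other
  exponents are unchanged.\<close>

lemma map_mon_collapse_inj:
  assumes "0 < p" "\<And>i. i < p \<Longrightarrow> Poly_Mapping.lookup m i = a" "\<And>i. i < p \<Longrightarrow> Poly_Mapping.lookup m' i = a'"
    and "map_mon (collapse p) m = map_mon (collapse p) m'"
  shows "m = m'"
proof (rule poly_mapping_eqI)
  fix j
  have "p * a = p * a'"
    using lookup_map_mon_collapse(2)[OF assms(1), of m] lookup_map_mon_collapse(2)[OF assms(1), of m'] assms
    by simp
  then show "Poly_Mapping.lookup m j = Poly_Mapping.lookup m' j"
    using assms lookup_map_mon_collapse(1)[OF assms(1), of j m] lookup_map_mon_collapse(1)[OF assms(1), of j m']
    by (cases "j < p") auto
qed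

text \<open>A level set with at least p elements inside \<open>{..<p}\<close> is all of it.\<close>

lemma not_p_regular_lessThan:
  assumes "\<not> p_regular p {..<p} m"
  obtains a where "\<And>i. i < p \<Longrightarrow> Poly_Mapping.lookup m i = a"
proof -
  obtain a where "p \<le> card {i \<in> {..<p}. Poly_Mapping.lookup m i = a}"
    using assms by (auto simp: p_regular_def not_less)
  then have "{i \<in> {..<p}. Poly_Mapping.lookup m i = a} = {..<p}"
    by (intro card_seteq) auto
  then show thesis using that[of a] by blast
qed

text \<open>Glue a bijection from \<open>S\<close> to \<open>T\<close> with one between the
  complements in \<open>A\<close>, and take the identity outside \<open>A\<close>.\<close>

lemma permutes_map_subset:
  assumes "finite A" "S \<subseteq> A" "T \<subseteq> A" "card S = card T"
  obtains \<sigma> where "\<sigma> permutes A" "\<sigma> ` S = T"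
proof -
  have fin: "finite S" "finite T" using assms finite_subset by blast+
  obtain g where g: "bij_betw g S T"
    using finite_same_card_bij[OF fin assms(4)] by blast
  have "card (A - S) = card (A - T)"
    using assms fin by (simp add: card_Diff_subset)
  then obtain h where h: "bij_betw h (A - S) (A - T)"
    using finite_same_card_bij assms(1) by blast
  define \<sigma> where "\<sigma> i = (if i \<in> S then g i else if i \<in> A then h i else i)" for i
  have "bij_betw \<sigma> S T" using g by (subst bij_betw_cong[of _ _ g]) (auto simp: \<sigma>_def)
  moreover have "bij_betw \<sigma> (A - S) (A - T)"
    using h by (subst bij_betw_cong[of _ _ h]) (auto simp: \<sigma>_def)
  ultimately have "bij_betw \<sigma> (S \<union> (A - S)) (T \<union> (A - T))"
    by (rule bij_betw_combine) auto
  then have "bij_betw \<sigma> A A" using assms(2,3) by (simp add: Un_absorb1)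
  then have "\<sigma> permutes A" by (rule bij_imp_permutes) (use assms(2) in \<open>auto simp: \<sigma>_def\<close>)
  moreover have "\<sigma> ` S = T" using \<open>bij_betw \<sigma> S T\<close> by (simp add: bij_betw_def)
  ultimately show thesis by (rule that)
qed

text \<open>Modulo transfers for \<open>{..<p}\<close>, which the substitution kills,
  \<open>c\<close> consists of monomials constant on the first p positions. On these the
  substitution is injective, so no cancellation can hide a coefficient.\<close>

lemma restr_eq_0_imp_lookup_eq_0:
  fixes c :: "'a::field mpol"
  assumes p: "prime p" "CHAR('a) = p"
    and inv: "\<And>\<sigma>. \<sigma> permutes {..<p} \<Longrightarrow> perm_act \<sigma> c = c"
    and "restr p c = 0" and "\<And>i. i < p \<Longrightarrow> Poly_Mapping.lookup m i = a"
  shows "Poly_Mapping.lookup c m = 0"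
proof -
  have p0: "0 < p" using p(1) prime_gt_0_nat by blast
  obtain f where f: "\<And>m. Poly_Mapping.lookup (c - transfer_on {..<p} f) m =
      (if p_regular p {..<p} m then 0 else Poly_Mapping.lookup c m)"
    using invariant_decomposition[OF p finite_lessThan inv] by blast
  define c0 where "c0 = c - transfer_on {..<p} f"
  have "restr p c0 = 0"
    using assms(4) restr_transfer_on_eq_0[OF p order_refl, of f]
    by (simp add: c0_def rhom_diff[OF rhom_restr])
  moreover have "map_mon (collapse p) m' = map_mon (collapse p) m \<longleftrightarrow> m' = m"
    if "m' \<in> Poly_Mapping.keys c0" for m'
  proof -
    have "\<not> p_regular p {..<p} m'" using that f[of m'] by (auto simp: c0_def in_keys_iff)
    then show ?thesis
      using not_p_regular_lessThan map_mon_collapse_inj[OF p0 _ assms(5), of m'] by blast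
  qed
  then have "Poly_Mapping.lookup (restr p c0) (map_mon (collapse p) m)
      = (\<Sum>m'\<in>Poly_Mapping.keys c0. if m' = m then Poly_Mapping.lookup c0 m' else 0)"
    unfolding restr_def ins_const_var lookup_sum lookup_single when_def
    by (intro sum.cong) auto
  then have "Poly_Mapping.lookup (restr p c0) (map_mon (collapse p) m) = Poly_Mapping.lookup c0 m"
    by (simp add: in_keys_iff)
  \<comment> \<open>The monomial \<open>m\<close> is itself irregular, so passing from
    \<open>c\<close> to \<open>c0\<close> did not change its coefficient.\<close>
  moreover have "{i \<in> {..<p}. Poly_Mapping.lookup m i = a} = {..<p}" using assms(5) by auto
  then have "card {i \<in> {..<p}. Poly_Mapping.lookup m i = a} = p" by simp
  then have "\<not> p_regular p {..<p} m"
    unfolding p_regular_def by (metis less_irrefl)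
  ultimately show ?thesis using f[of m] by (simp add: c0_def)
qed

text \<open>For the harder inclusion, a symmetric \<open>c\<close> in the kernel has only regular
  monomials, so the decomposition above leaves no remainder and exhibits \<open>c\<close> as a
  transfer.\<close>

lemma transfer_image_eq_kernel_restr:
  assumes p: "prime p" "CHAR('a::field) = p" "p \<le> n"
  shows "(transfer_image n :: 'a mpol set) = {c \<in> sym_polys n. restr p c = 0}"
proof (intro equalityI subsetI)
  fix c :: "'a mpol" assume "c \<in> transfer_image n"
  then show "c \<in> {c \<in> sym_polys n. restr p c = 0}"
    using transfer_in_sym_polys restr_transfer_on_eq_0[OF p]
    by (auto simp: transfer_image_def transfer_eq)
next
  fix c :: "'a mpol" assume "c \<in> {c \<in> sym_polys n. restr p c = 0}"
  then have c: "c \<in> polyring n" "\<And>\<sigma>. \<sigma> permutes {..<n} \<Longrightarrow> perm_act \<sigma> c = c" "restr p c = 0"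
    by (auto simp: sym_polys_def)
  have inv: "perm_act \<sigma> c = c" if "\<sigma> permutes {..<p}" for \<sigma>
    using c(2) permutes_subset[OF that, of "{..<n}"] p(3) by auto
  \<comment> \<open>An irregular monomial has p equal exponents. A permutation of the variables
    moves them to the first p positions, where the coefficient is known to vanish; by symmetry it
    vanishes at \<open>m\<close> as well.\<close>
  have reg: "p_regular p {..<n} m" if m: "m \<in> Poly_Mapping.keys c" for m
  proof (rule ccontr)
    assume "\<not> p_regular p {..<n} m"
    then obtain a where "p \<le> card {i \<in> {..<n}. Poly_Mapping.lookup m i = a}"
      by (auto simp: p_regular_def not_less)
    then obtain T where T: "T \<subseteq> {i \<in> {..<n}. Poly_Mapping.lookup m i = a}" "card T = p"
      by (meson obtain_subset_with_card_n)
    then have T_n: "T \<subseteq> {..<n}" and T_p: "card {..<p} = card T" by auto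
    obtain \<sigma> where \<sigma>: "\<sigma> permutes {..<n}" "\<sigma> ` {..<p} = T"
      by (rule permutes_map_subset[OF finite_lessThan _ T_n T_p]) (use p(3) in auto)
    have "Poly_Mapping.lookup (map_mon (inv \<sigma>) m) i = a" if "i < p" for i
      using that \<sigma> T(1) by (auto simp: lookup_map_mon_inv permutes_bij)
    then have "Poly_Mapping.lookup c (map_mon (inv \<sigma>) m) = 0"
      using restr_eq_0_imp_lookup_eq_0[OF p(1,2) inv c(3)] by blast
    then show False
      using m lookup_perm_act[OF permutes_bij[OF \<sigma>(1)], of c m] c(2)[OF \<sigma>(1)]
      by (simp add: in_keys_iff)
  qed
  obtain f where f: "Poly_Mapping.keys f \<subseteq> Poly_Mapping.keys c"
    "\<And>m. Poly_Mapping.lookup (c - transfer_on {..<n} f) m =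
      (if p_regular p {..<n} m then 0 else Poly_Mapping.lookup c m)"
    using invariant_decomposition[OF p(1,2) finite_lessThan c(2)] by blast
  have "c - transfer_on {..<n} f = 0"
    by (rule poly_mapping_eqI) (use f(2) reg in \<open>auto simp: in_keys_iff\<close>)
  moreover have "f \<in> polyring n"
    using f(1) c(1) by (auto simp: polyring_def)
  ultimately show "c \<in> transfer_image n"
    by (auto simp: transfer_image_def transfer_eq)
qed

section \<open>Symmetric polynomials\<close>

text \<open>Stated for values in any ring and any index set, because it is needed for images under
  homomorphisms and for the variables \<open>{p..<n}\<close>.\<close>

definition esym :: "('i \<Rightarrow> 'b::comm_ring_1) \<Rightarrow> 'i set \<Rightarrow> nat \<Rightarrow> 'b" where
  "esym v B i = (\<Sum>S\<in>{S. S \<subseteq> B \<and> card S = i}. \<Prod>j\<in>S. v j)"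

lemma elem_sym_eq_esym: "elem_sym n = esym var {..<n}"
  by (simp add: fun_eq_iff elem_sym_def esym_def var_def prod_single_1)

lemma rhom_esym: "rhom h \<Longrightarrow> h (esym v B i) = esym (\<lambda>j. h (v j)) B i"
  by (simp add: esym_def rhom_sum rhom_prod)

lemma prod_monom_1: "(\<Prod>j\<in>S. monom (v j) (Suc 0)) = monom (\<Prod>j\<in>S. v j) (card S)"
  for v :: "'i \<Rightarrow> 'b::comm_ring_1"
  by (induction S rule: infinite_finite_induct) (auto simp: mult_monom)

text \<open>The generating product is taken in the reversed form with factors 1 + v_j z, so that the
  coefficient index equals the degree and needs no complement.\<close>

lemma coeff_prod_linear:
  fixes v :: "'i \<Rightarrow> 'b::comm_ring_1"
  assumes "finite B"
  shows "coeff (\<Prod>j\<in>B. [:1, v j:]) i = esym v B i"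
proof -
  have "(\<Prod>j\<in>B. [:1, v j:]) = (\<Prod>j\<in>B. monom (v j) 1 + 1)"
    by (intro prod.cong) (auto simp: monom_altdef one_pCons)
  also have "\<dots> = (\<Sum>S\<in>Pow B. monom (\<Prod>j\<in>S. v j) (card S))"
    using prod_add[OF assms, of "\<lambda>j. monom (v j) 1" "\<lambda>_. 1"] by (simp add: prod_monom_1)
  also have "coeff \<dots> i = (\<Sum>S\<in>Pow B. if card S = i then \<Prod>j\<in>S. v j else 0)"
    by (simp add: coeff_sum)
  also have "\<dots> = (\<Sum>S\<in>{S \<in> Pow B. card S = i}. \<Prod>j\<in>S. v j)"
    by (rule sum.inter_filter[symmetric]) (use assms in simp)
  also have "\<dots> = esym v B i"
    by (simp add: esym_def)
  finally show ?thesis .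
qed

lemma esym_0: "finite B \<Longrightarrow> esym v B 0 = 1"
proof -
  assume "finite B"
  then have "{S. S \<subseteq> B \<and> card S = 0} = {{}}" using finite_subset by fastforce
  then show ?thesis unfolding esym_def by simp
qed

lemma esym_gt_card:
  assumes "finite B" "card B < i"
  shows "esym v B i = 0"
proof -
  have "card S \<noteq> i" if "S \<subseteq> B" for S using card_mono[OF assms(1) that] assms(2) by simp
  then show ?thesis unfolding esym_def by (intro sum.neutral) blast
qed

lemma var_in_polyring: "i < n \<Longrightarrow> var i \<in> polyring n"
  unfolding var_def by (rule polyring_single) simp

lemma elem_sym_in_sym_polys: "(elem_sym n i :: 'a::comm_ring_1 mpol) \<in> sym_polys n"
proof -
  have "perm_act \<sigma> (elem_sym n i :: 'a mpol) = elem_sym n i" if "\<sigma> permutes {..<n}" for \<sigma>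
    using prod.permute[OF that, of "\<lambda>j. [:1, var j :: 'a mpol:]"]
    unfolding elem_sym_eq_esym rhom_esym[OF rhom_perm_act] perm_act_var
    unfolding coeff_prod_linear[OF finite_lessThan, symmetric] comp_def by simp
  moreover have "(elem_sym n i :: 'a mpol) \<in> polyring n"
    unfolding elem_sym_eq_esym esym_def
    by (intro subring_sum[OF subring_polyring] subring_prod[OF subring_polyring] var_in_polyring) auto
  ultimately show ?thesis by (simp add: sym_polys_def)
qed

section \<open>Lexicographic leading monomials\<close>

text \<open>The order on finitely supported maps is lexicographic: the smallest index at which two
  exponent vectors differ decides.\<close>

lemma less_monomialI:
  fixes m m' :: "nat \<Rightarrow>\<^sub>0 nat"
  assumes "Poly_Mapping.lookup m k < Poly_Mapping.lookup m' k"
    and "\<And>k'. k' < k \<Longrightarrow> Poly_Mapping.lookup m k' = Poly_Mapping.lookup m' k'"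
  shows "m < m'"
  unfolding less_poly_mapping.rep_eq less_fun_def using assms by blast

definition monic_lead :: "'a::comm_ring_1 mpol \<Rightarrow> (nat \<Rightarrow>\<^sub>0 nat) \<Rightarrow> bool" where
  "monic_lead f m \<longleftrightarrow> Poly_Mapping.lookup f m = 1 \<and> (\<forall>m'\<in>Poly_Mapping.keys f. m' \<le> m)"

lemma monic_lead_single: "monic_lead (Poly_Mapping.single m 1) m"
  by (auto simp: monic_lead_def split: if_splits)

lemma lookup_mult_sum:
  fixes f g :: "'a::comm_ring_1 mpol"
  shows "Poly_Mapping.lookup (f * g) m = (\<Sum>k\<in>Poly_Mapping.keys f. \<Sum>l\<in>Poly_Mapping.keys g.
    if k + l = m then Poly_Mapping.lookup f k * Poly_Mapping.lookup g l else 0)"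
  by (simp add: mult_eq_sum_singles[of f g] lookup_sum lookup_single when_def)

text \<open>Addition is strictly monotone for the order, so among pairs of occurring monomials only
  \<open>m\<close> and \<open>m'\<close> can have the sum \<open>m + m'\<close>. Its coefficient is
  1 times 1.\<close>

lemma monic_lead_mult:
  assumes "monic_lead f m" "monic_lead g m'"
  shows "monic_lead (f * g) (m + m')"
proof -
  have le: "k \<le> m" if "k \<in> Poly_Mapping.keys f" for k using that assms by (simp add: monic_lead_def)
  have le': "l \<le> m'" if "l \<in> Poly_Mapping.keys g" for l using that assms by (simp add: monic_lead_def)
  have eq: "k + l = m + m' \<longleftrightarrow> k = m \<and> l = m'"
    if "k \<in> Poly_Mapping.keys f" "l \<in> Poly_Mapping.keys g" for k l
    using le[OF that(1)] le'[OF that(2)] add_less_le_mono[of k m l m'] by (auto simp: order_le_less)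
  have "Poly_Mapping.lookup (f * g) (m + m') = (\<Sum>k\<in>Poly_Mapping.keys f. \<Sum>l\<in>Poly_Mapping.keys g.
      if k = m \<and> l = m' then Poly_Mapping.lookup f k * Poly_Mapping.lookup g l else 0)"
    unfolding lookup_mult_sum by (intro sum.cong refl) (simp add: eq)
  also have "\<dots> = (\<Sum>k\<in>Poly_Mapping.keys f. if k = m then (\<Sum>l\<in>Poly_Mapping.keys g.
      if l = m' then Poly_Mapping.lookup f k * Poly_Mapping.lookup g l else 0) else 0)"
    by (intro sum.cong refl) auto
  also have "\<dots> = 1"
    using assms by (auto simp: in_keys_iff monic_lead_def)
  finally have "Poly_Mapping.lookup (f * g) (m + m') = 1" .
  moreover have "k \<le> m + m'" if k: "k \<in> Poly_Mapping.keys (f * g)" for k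
  proof -
    obtain a b where "k = a + b" "a \<in> Poly_Mapping.keys f" "b \<in> Poly_Mapping.keys g"
      using k keys_mult[of f g] by blast
    then show ?thesis using le le' by (simp add: add_mono)
  qed
  ultimately show ?thesis by (simp add: monic_lead_def)
qed

definition mon_scale :: "nat \<Rightarrow> (nat \<Rightarrow>\<^sub>0 nat) \<Rightarrow> (nat \<Rightarrow>\<^sub>0 nat)" where
  "mon_scale k m = ((+) m ^^ k) 0"

lemma lookup_mon_scale: "Poly_Mapping.lookup (mon_scale k m) j = k * Poly_Mapping.lookup m j"
  by (induction k) (auto simp: mon_scale_def lookup_add)

text \<open>The leading monomial of the monomial with exponents \<open>\<alpha>\<close> after
  variable \<open>i\<close> has been replaced by an element with leading monomial
  \<open>L i\<close>.\<close>

definition mon_subst :: "(nat \<Rightarrow> (nat \<Rightarrow>\<^sub>0 nat)) \<Rightarrow> (nat \<Rightarrow>\<^sub>0 nat) \<Rightarrow> (nat \<Rightarrow>\<^sub>0 nat)" where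
  "mon_subst L \<alpha> = (\<Sum>i\<in>Poly_Mapping.keys \<alpha>. mon_scale (Poly_Mapping.lookup \<alpha> i) (L i))"

lemma lookup_mon_subst:
  assumes "finite K" "Poly_Mapping.keys \<alpha> \<subseteq> K"
  shows "Poly_Mapping.lookup (mon_subst L \<alpha>) j
    = (\<Sum>i\<in>K. Poly_Mapping.lookup \<alpha> i * Poly_Mapping.lookup (L i) j)"
  unfolding mon_subst_def lookup_sum lookup_mon_scale
  by (rule sum.mono_neutral_left) (use assms in \<open>auto simp: in_keys_iff\<close>)

lemma monic_lead_power: "monic_lead f m \<Longrightarrow> monic_lead (f ^ k) (mon_scale k m)"
proof (induction k)
  case 0
  show ?case using monic_lead_single[of 0] by (simp add: mon_scale_def)
next
  case (Suc k)
  then show ?case using monic_lead_mult[of f m "f ^ k" "mon_scale k m"] by (simp add: mon_scale_def)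
qed

lemma monic_lead_prod:
  assumes "finite I" "\<And>i. i \<in> I \<Longrightarrow> monic_lead (f i) (m i)"
  shows "monic_lead (\<Prod>i\<in>I. f i) (\<Sum>i\<in>I. m i)"
  using assms monic_lead_single[of 0]
  by (induction I rule: finite_induct) (auto simp: monic_lead_mult)

lemma monic_lead_mon_val:
  assumes "\<And>i. i \<in> Poly_Mapping.keys \<alpha> \<Longrightarrow> monic_lead (v i) (L i)"
  shows "monic_lead (mon_val v \<alpha>) (mon_subst L \<alpha>)"
  unfolding mon_val_def mon_subst_def
  by (intro monic_lead_prod monic_lead_power assms) auto

lemma lookup_const_mult:
  "Poly_Mapping.lookup (const_mpol a * f) m = a * Poly_Mapping.lookup f m"
proof (cases "a = 0")
  case False
  then have "Poly_Mapping.lookup (const_mpol a * f) m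
      = (\<Sum>l\<in>Poly_Mapping.keys f. if l = m then a * Poly_Mapping.lookup f l else 0)"
    by (simp add: lookup_mult_sum)
  also have "\<dots> = a * Poly_Mapping.lookup f m"
    by (simp add: in_keys_iff)
  finally show ?thesis .
qed simp

text \<open>Criterion for algebraic independence: if distinct monomials in the \<open>v i\<close>
  have distinct leading monomials, the largest of these cannot cancel in a relation.\<close>

lemma ins_eq_0_imp_eq_0:
  fixes F :: "'a::comm_ring_1 mpol"
  assumes "ins const_mpol v F = 0"
    and keys: "\<And>\<alpha>. \<alpha> \<in> Poly_Mapping.keys F \<Longrightarrow> Poly_Mapping.keys \<alpha> \<subseteq> K"
    and lead: "\<And>i. i \<in> K \<Longrightarrow> monic_lead (v i) (L i)"
    and inj: "inj_on (mon_subst L) {\<alpha>. Poly_Mapping.keys \<alpha> \<subseteq> K}"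
  shows "F = 0"
proof (rule ccontr)
  assume "F \<noteq> 0"
  then have ne: "Poly_Mapping.keys F \<noteq> {}" by simp
  define \<mu> where "\<mu> = Max (mon_subst L ` Poly_Mapping.keys F)"
  have "\<mu> \<in> mon_subst L ` Poly_Mapping.keys F"
    unfolding \<mu>_def using ne by (intro Max_in) auto
  then obtain \<alpha> where \<alpha>: "\<alpha> \<in> Poly_Mapping.keys F" "\<mu> = mon_subst L \<alpha>" by blast
  have zero: "Poly_Mapping.lookup (mon_val v \<beta>) \<mu> = (if \<beta> = \<alpha> then 1 else 0)"
    if \<beta>: "\<beta> \<in> Poly_Mapping.keys F" for \<beta>
  proof -
    have l: "monic_lead (mon_val v \<beta>) (mon_subst L \<beta>)"
      using keys[OF \<beta>] lead by (intro monic_lead_mon_val) auto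
    have "mon_subst L \<beta> \<le> \<mu>" unfolding \<mu>_def using \<beta> by (intro Max_ge) auto
    moreover have "mon_subst L \<beta> \<noteq> \<mu>" if "\<beta> \<noteq> \<alpha>"
      using that inj_onD[OF inj, of \<beta> \<alpha>] keys[OF \<beta>] keys[OF \<alpha>(1)] \<alpha>(2) by auto
    ultimately have "\<mu> \<notin> Poly_Mapping.keys (mon_val v \<beta>)" if "\<beta> \<noteq> \<alpha>"
      using that l unfolding monic_lead_def by fastforce
    then show ?thesis using l \<alpha>(2) by (auto simp: in_keys_iff monic_lead_def)
  qed
  have "Poly_Mapping.lookup (ins const_mpol v F) \<mu>
      = (\<Sum>\<beta>\<in>Poly_Mapping.keys F. if \<beta> = \<alpha> then Poly_Mapping.lookup F \<beta> else 0)"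
    unfolding ins_def lookup_sum lookup_const_mult by (intro sum.cong refl) (simp add: zero)
  also have "\<dots> = Poly_Mapping.lookup F \<alpha>" using \<alpha>(1) by simp
  finally show False using assms(1) \<alpha>(1) by (simp add: in_keys_iff)
qed

definition set_mon :: "nat set \<Rightarrow> (nat \<Rightarrow>\<^sub>0 nat)" where
  "set_mon S = (\<Sum>j\<in>S. Poly_Mapping.single j 1)"

lemma lookup_set_mon: "finite S \<Longrightarrow> Poly_Mapping.lookup (set_mon S) j = (if j \<in> S then 1 else 0)"
  by (simp add: set_mon_def lookup_sum lookup_single when_def)

text \<open>At the smallest index \<open>k\<close> of the initial segment that is missing from
  \<open>S\<close>, the segment has exponent 1 and \<open>S\<close> has 0; below \<open>k\<close>
  they agree.\<close>

lemma set_mon_le_initial: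
  assumes "S \<subseteq> {a..<b}" "card S = i" "finite S"
  shows "set_mon S \<le> set_mon {a..<a + i}"
proof (cases "{a..<a + i} \<subseteq> S")
  case True
  then have "{a..<a + i} = S" using assms by (intro card_subset_eq) auto
  then show ?thesis by simp
next
  case False
  define k where "k = Min ({a..<a + i} - S)"
  have "k \<in> {a..<a + i} - S" unfolding k_def using False by (intro Min_in) auto
  moreover have "k' \<in> S \<longleftrightarrow> k' \<in> {a..<a + i}" if "k' < k" for k'
  proof
    assume "k' \<in> S"
    then show "k' \<in> {a..<a + i}" using assms(1) that \<open>k \<in> {a..<a + i} - S\<close> by auto
  next
    assume "k' \<in> {a..<a + i}"
    then show "k' \<in> S"
      using that Min_le[of "{a..<a + i} - S" k'] unfolding k_def by fastforce
  qed
  ultimately have "set_mon S < set_mon {a..<a + i}"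
    by (intro less_monomialI[of _ k]) (auto simp: lookup_set_mon assms(3))
  then show ?thesis by simp
qed

lemma set_mon_eq_iff: "finite S \<Longrightarrow> finite T \<Longrightarrow> set_mon S = set_mon T \<longleftrightarrow> S = T"
  by (auto simp: poly_mapping_eq_iff fun_eq_iff lookup_set_mon split: if_splits)

lemma monic_lead_esym:
  assumes "i \<le> N"
  shows "monic_lead (esym var {a..<a + N} i :: 'a::comm_ring_1 mpol) (set_mon {a..<a + i})"
proof -
  let ?S = "{S. S \<subseteq> {a..<a + N} \<and> card S = i}" and ?T = "{a..<a + i}"
  have fin: "finite S" if "S \<in> ?S" for S using that finite_subset by blast
  have fin_S: "finite ?S" by (rule finite_subset[of _ "Pow {a..<a + N}"]) auto
  have e: "(esym var {a..<a + N} i :: 'a mpol) = (\<Sum>S\<in>?S. Poly_Mapping.single (set_mon S) 1)"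
    by (simp add: esym_def set_mon_def var_def prod_single_1)
  have eq: "set_mon S = set_mon ?T \<longleftrightarrow> S = ?T" if "S \<in> ?S" for S
    by (rule set_mon_eq_iff[OF fin[OF that]]) simp
  have "Poly_Mapping.lookup (esym var {a..<a + N} i :: 'a mpol) (set_mon ?T)
      = (\<Sum>S\<in>?S. if S = ?T then 1 else 0)"
    unfolding e lookup_sum lookup_single when_def
    by (intro sum.cong refl) (simp only: eq)
  also have "\<dots> = 1" using assms fin_S by simp
  finally have "Poly_Mapping.lookup (esym var {a..<a + N} i :: 'a mpol) (set_mon ?T) = 1" .
  moreover have "m \<le> set_mon ?T" if m: "m \<in> Poly_Mapping.keys (esym var {a..<a + N} i :: 'a mpol)" for m
  proof -
    have "\<exists>S\<in>?S. set_mon S = m"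
    proof (rule ccontr)
      assume "\<not> (\<exists>S\<in>?S. set_mon S = m)"
      then have "Poly_Mapping.lookup (esym var {a..<a + N} i :: 'a mpol) m = 0"
        unfolding e lookup_sum lookup_single when_def by (intro sum.neutral) auto
      then show False using m by (simp add: in_keys_iff)
    qed
    then obtain S where "S \<in> ?S" "set_mon S = m" by blast
    then show ?thesis using set_mon_le_initial[of S a "a + N" i] fin[of S] by simp
  qed
  ultimately show ?thesis by (simp add: monic_lead_def)
qed

section \<open>Symmetric polynomials are generated by the elementary ones\<close>

lemma keys_perm_closed:
  assumes "c \<in> sym_polys n" "\<sigma> permutes {..<n}" "m \<in> Poly_Mapping.keys c"
  shows "map_mon (inv \<sigma>) m \<in> Poly_Mapping.keys c"
  using assms lookup_perm_act[OF permutes_bij[OF assms(2)], of c m]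
  by (auto simp: sym_polys_def in_keys_iff)

text \<open>Otherwise swapping positions 0 and \<open>i\<close> gives a monomial of \<open>c\<close>
  above \<open>\<nu>\<close>. The bound later keeps products of elementary symmetric polynomials
  inside a finite box of exponents.\<close>

lemma lookup_le_lead_0:
  assumes "c \<in> sym_polys n" "\<And>m. m \<in> Poly_Mapping.keys c \<Longrightarrow> m \<le> \<nu>"
    and "m \<in> Poly_Mapping.keys c" "i < n"
  shows "Poly_Mapping.lookup m i \<le> Poly_Mapping.lookup \<nu> 0"
proof (rule ccontr)
  assume neg: "\<not> Poly_Mapping.lookup m i \<le> Poly_Mapping.lookup \<nu> 0"
  let ?\<sigma> = "transpose 0 i"
  have \<sigma>: "?\<sigma> permutes {..<n}" using assms(4) by (intro permutes_swap_id) auto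
  have "Poly_Mapping.lookup (map_mon (inv ?\<sigma>) m) 0 = Poly_Mapping.lookup m i"
    using lookup_map_mon_inv[OF permutes_bij[OF \<sigma>], of m 0] by simp
  then have "\<nu> < map_mon (inv ?\<sigma>) m"
    using neg by (intro less_monomialI[of _ 0]) auto
  then show False
    using assms(2)[OF keys_perm_closed[OF assms(1) \<sigma> assms(3)]] by simp
qed

text \<open>Swapping two adjacent exponents in increasing order would give a larger monomial of
  \<open>c\<close>; so leading monomials of symmetric polynomials are partitions.\<close>

lemma lead_decreasing:
  assumes "c \<in> sym_polys n" "\<And>m. m \<in> Poly_Mapping.keys c \<Longrightarrow> m \<le> \<nu>"
    and "\<nu> \<in> Poly_Mapping.keys c"
  shows "Poly_Mapping.lookup \<nu> (Suc k) \<le> Poly_Mapping.lookup \<nu> k"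
proof (cases "Suc k < n")
  case False
  have "Poly_Mapping.keys \<nu> \<subseteq> {..<n}" using assms(1,3) by (simp add: sym_polys_def polyring_def)
  then have "Suc k \<notin> Poly_Mapping.keys \<nu>" using False by auto
  then show ?thesis by (simp add: in_keys_iff)
next
  case True
  show ?thesis
  proof (rule ccontr)
    assume neg: "\<not> Poly_Mapping.lookup \<nu> (Suc k) \<le> Poly_Mapping.lookup \<nu> k"
    let ?\<sigma> = "transpose k (Suc k)"
    have \<sigma>: "?\<sigma> permutes {..<n}" using True by (intro permutes_swap_id) auto
    have lookup: "Poly_Mapping.lookup (map_mon (inv ?\<sigma>) \<nu>) j = Poly_Mapping.lookup \<nu> (?\<sigma> j)" for j
      by (rule lookup_map_mon_inv[OF permutes_bij[OF \<sigma>]])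
    have "\<nu> < map_mon (inv ?\<sigma>) \<nu>"
      using neg by (intro less_monomialI[of _ k]; unfold lookup) auto
    then show False
      using assms(2)[OF keys_perm_closed[OF assms(1) \<sigma> assms(3)]] by simp
  qed
qed

lemma sum_consecutive_diffs:
  fixes u :: "nat \<Rightarrow> nat"
  assumes "\<And>k. u (Suc k) \<le> u k" "j \<le> k"
  shows "(\<Sum>i\<in>{Suc j..k}. u (i - 1) - u i) = u j - u k"
  using assms(2)
proof (induction k rule: dec_induct)
  case (step k)
  have "u k \<le> u j" using step.hyps assms(1) lift_Suc_antimono_le[of u] by blast
  then show ?case using step assms(1)[of k] by simp
qed simp

text \<open>Finds the product of elementary symmetric polynomials with a prescribed leading
  monomial. The elementary polynomial of degree \<open>i\<close> leads with the variables below
  \<open>i\<close>, so the exponent at \<open>j\<close> is the sum of the exponents in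
  \<open>\<alpha>\<close> at all \<open>i > j\<close>.\<close>

lemma ex_exponent_of_partition:
  assumes "\<And>k. Poly_Mapping.lookup \<nu> (Suc k) \<le> Poly_Mapping.lookup \<nu> k"
    and "Poly_Mapping.keys \<nu> \<subseteq> {..<n}"
  shows "\<exists>\<alpha>. Poly_Mapping.keys \<alpha> \<subseteq> {..n} \<and> mon_subst (\<lambda>i. set_mon {0..<i}) \<alpha> = \<nu>"
proof -
  let ?u = "Poly_Mapping.lookup \<nu>"
  \<comment> \<open>Consecutive differences invert these tail sums; the last tail ends correctly
    because \<open>\<nu>\<close> vanishes at \<open>n\<close>.\<close>
  define \<alpha> where "\<alpha> = (\<Sum>i\<in>{1..n}. Poly_Mapping.single i (?u (i - 1) - ?u i))"
  have \<alpha>: "Poly_Mapping.lookup \<alpha> i = (if i \<in> {1..n} then ?u (i - 1) - ?u i else 0)" for i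
    unfolding \<alpha>_def lookup_sum lookup_single when_def by simp
  have keys: "Poly_Mapping.keys \<alpha> \<subseteq> {1..n}" by (auto simp: in_keys_iff \<alpha> split: if_splits)
  have u0: "?u j = 0" if "n \<le> j" for j using assms(2) that by (fastforce simp: in_keys_iff)
  have "mon_subst (\<lambda>i. set_mon {0..<i}) \<alpha> = \<nu>"
  proof (rule poly_mapping_eqI)
    fix j
    have "Poly_Mapping.lookup (mon_subst (\<lambda>i. set_mon {0..<i}) \<alpha>) j
        = (\<Sum>i\<in>{1..n}. if j < i then ?u (i - 1) - ?u i else 0)"
      unfolding lookup_mon_subst[OF finite_atLeastAtMost keys]
      by (intro sum.cong refl) (simp add: lookup_set_mon \<alpha>)
    also have "\<dots> = (\<Sum>i\<in>{Suc j..n}. ?u (i - 1) - ?u i)"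
      by (rule sum.mono_neutral_cong_right) auto
    also have "\<dots> = ?u j"
      using sum_consecutive_diffs[of ?u j n] assms(1) u0 by (cases "j \<le> n") auto
    finally show "Poly_Mapping.lookup (mon_subst (\<lambda>i. set_mon {0..<i}) \<alpha>) j = ?u j" .
  qed
  then show ?thesis using keys by (intro exI[of _ \<alpha>]) auto
qed

lemma finite_mon_box: "finite {m :: nat \<Rightarrow>\<^sub>0 nat. Poly_Mapping.keys m \<subseteq> {..<n} \<and> (\<forall>i. Poly_Mapping.lookup m i \<le> N)}"
proof -
  let ?B = "{m :: nat \<Rightarrow>\<^sub>0 nat. Poly_Mapping.keys m \<subseteq> {..<n} \<and> (\<forall>i. Poly_Mapping.lookup m i \<le> N)}"
  let ?F = "{f. \<forall>i. (i \<in> {..<n} \<longrightarrow> f i \<in> {..N}) \<and> (i \<notin> {..<n} \<longrightarrow> f i = 0)}"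
  have "finite ?F" by (rule finite_set_of_finite_funs) auto
  moreover have "Poly_Mapping.lookup ` ?B \<subseteq> ?F" by (auto simp: in_keys_iff subset_iff)
  ultimately have "finite (Poly_Mapping.lookup ` ?B)" by (rule rev_finite_subset)
  moreover have "inj_on Poly_Mapping.lookup ?B"
    by (rule inj_onI) (rule iffD2[OF poly_mapping_eq_iff])
  ultimately show ?thesis by (rule finite_imageD)
qed

text \<open>The existence half of the fundamental theorem of symmetric polynomials, by cancelling
  the leading term repeatedly. In \<open>F\<close>, variable \<open>i\<close> stands for
  \<open>elem_sym n i\<close>.\<close>

lemma sym_poly_in_elem_sym:
  fixes c :: "'a::comm_ring_1 mpol"
  assumes "c \<in> sym_polys n"
  shows "\<exists>F. c = ins const_mpol (elem_sym n) F"
proof -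
  obtain N where N: "\<And>m i. m \<in> Poly_Mapping.keys c \<Longrightarrow> Poly_Mapping.lookup m i \<le> N"
  proof
    fix m i assume m: "m \<in> Poly_Mapping.keys c"
    show "Poly_Mapping.lookup m i \<le> (\<Sum>m\<in>Poly_Mapping.keys c. \<Sum>i\<in>Poly_Mapping.keys m. Poly_Mapping.lookup m i)"
    proof (cases "i \<in> Poly_Mapping.keys m")
      case True
      then have "Poly_Mapping.lookup m i \<le> (\<Sum>i\<in>Poly_Mapping.keys m. Poly_Mapping.lookup m i)"
        by (intro member_le_sum) auto
      also have "\<dots> \<le> (\<Sum>m\<in>Poly_Mapping.keys c. \<Sum>i\<in>Poly_Mapping.keys m. Poly_Mapping.lookup m i)"
        using m by (intro member_le_sum[of m]) auto
      finally show ?thesis .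
    qed (simp add: in_keys_iff)
  qed
  let ?B = "{m :: nat \<Rightarrow>\<^sub>0 nat. Poly_Mapping.keys m \<subseteq> {..<n} \<and> (\<forall>i. Poly_Mapping.lookup m i \<le> N)}"
  \<comment> \<open>Lexicographic initial segments can be infinite, so the induction counts only
    those monomials of the box \<open>?B\<close> that lie below some monomial of the
    polynomial.\<close>
  let ?D = "\<lambda>c :: 'a mpol. {m \<in> ?B. \<exists>m'\<in>Poly_Mapping.keys c. m \<le> m'}"
  have "Poly_Mapping.keys c \<subseteq> ?B" using N assms by (auto simp: sym_polys_def polyring_def)
  then show ?thesis using assms
  proof (induction "card (?D c)" arbitrary: c rule: less_induct)
    case less
    show ?case
    proof (cases "c = 0")
      case True
      then show ?thesis by (intro exI[of _ 0]) (simp add: ins_0)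
    next
      case False
      define \<mu> where "\<mu> = Max (Poly_Mapping.keys c)"
      have \<mu>: "\<mu> \<in> Poly_Mapping.keys c" unfolding \<mu>_def using False by (intro Max_in) auto
      have \<mu>_max: "m \<le> \<mu>" if "m \<in> Poly_Mapping.keys c" for m unfolding \<mu>_def using that by simp
      have \<mu>_B: "\<mu> \<in> ?B" using \<mu> less.prems(1) by blast
      obtain \<alpha> where \<alpha>: "Poly_Mapping.keys \<alpha> \<subseteq> {..n}" "mon_subst (\<lambda>i. set_mon {0..<i}) \<alpha> = \<mu>"
        using ex_exponent_of_partition[of \<mu> n] lead_decreasing[OF less.prems(2) \<mu>_max \<mu>] \<mu>_B by blast
      define E :: "'a mpol" where "E = mon_val (elem_sym n) \<alpha>"
      have "monic_lead (elem_sym n i :: 'a mpol) (set_mon {0..<i})" if "i \<in> Poly_Mapping.keys \<alpha>" for i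
        using that \<alpha>(1) monic_lead_esym[of i n 0] by (auto simp: elem_sym_eq_esym atLeast0LessThan)
      then have lead_E: "monic_lead E \<mu>"
        unfolding E_def \<alpha>(2)[symmetric] by (rule monic_lead_mon_val)
      have E_sym: "E \<in> sym_polys n"
        unfolding E_def by (intro subring_mon_val subring_sym_polys elem_sym_in_sym_polys)
      \<comment> \<open>Subtracting a multiple of \<open>E\<close> must not leave the box: every
        exponent in \<open>E\<close> is at most the first exponent of \<open>\<mu>\<close>, hence at
        most \<open>N\<close>.\<close>
      have keys_E: "Poly_Mapping.keys E \<subseteq> ?B"
      proof
        fix m assume m: "m \<in> Poly_Mapping.keys E"
        have keys_m: "Poly_Mapping.keys m \<subseteq> {..<n}" using E_sym m by (auto simp: sym_polys_def polyring_def)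
        have "Poly_Mapping.lookup m i \<le> N" for i
        proof (cases "i < n")
          case True
          then have "Poly_Mapping.lookup m i \<le> Poly_Mapping.lookup \<mu> 0"
            using lead_E m by (intro lookup_le_lead_0[OF E_sym]) (auto simp: monic_lead_def)
          also have "\<dots> \<le> N" using \<mu>_B by blast
          finally show ?thesis .
        next
          case False
          then have "i \<notin> Poly_Mapping.keys m" using keys_m by auto
          then show ?thesis by (simp add: in_keys_iff)
        qed
        then show "m \<in> ?B" using keys_m by blast
      qed
      define c' where "c' = c - const_mpol (Poly_Mapping.lookup c \<mu>) * E"
      have keys_c': "m \<in> ?B \<and> m < \<mu>" if m: "m \<in> Poly_Mapping.keys c'" for m
      proof -
        have "Poly_Mapping.lookup c' \<mu> = 0"
          using lead_E by (simp add: c'_def lookup_minus lookup_const_mult monic_lead_def)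
        then have "m \<noteq> \<mu>" using m by (auto simp: in_keys_iff)
        moreover have "m \<in> Poly_Mapping.keys c \<or> m \<in> Poly_Mapping.keys E"
          using m by (auto simp: c'_def lookup_minus lookup_const_mult in_keys_iff)
        ultimately show ?thesis
          using \<mu>_max[of m] lead_E keys_E less.prems(1) unfolding monic_lead_def by fastforce
      qed
      have "c' \<in> sym_polys n"
        unfolding c'_def using less.prems(2) E_sym const_in_sym_polys
        by (intro subring_diff[OF subring_sym_polys] subring_mult[OF subring_sym_polys]) auto
      \<comment> \<open>All monomials of \<open>c'\<close> are strictly below \<open>\<mu>\<close>,
        so the counted set loses at least \<open>\<mu>\<close>.\<close>
      moreover have "card (?D c') < card (?D c)"
      proof (rule psubset_card_mono)
        show "finite (?D c)" by (rule finite_subset[OF _ finite_mon_box[of n N]]) auto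
        have "?D c' \<subseteq> ?D c"
        proof
          fix m assume "m \<in> ?D c'"
          then obtain m' where "m \<in> ?B" "m' \<in> Poly_Mapping.keys c'" "m \<le> m'" by blast
          then have "m \<le> \<mu>" using keys_c'[of m'] by (meson less_imp_le order_trans)
          then show "m \<in> ?D c" using \<open>m \<in> ?B\<close> \<mu> by blast
        qed
        moreover have "\<mu> \<in> ?D c" using \<mu> \<mu>_B by blast
        moreover have "\<mu> \<notin> ?D c'" using keys_c' by (auto simp: not_le[symmetric])
        ultimately show "?D c' \<subset> ?D c" by blast
      qed
      moreover have "Poly_Mapping.keys c' \<subseteq> ?B" using keys_c' by blast
      ultimately obtain F where F: "c' = ins const_mpol (elem_sym n) F"
        using less.hyps[of c'] by blast
      have "ins const_mpol (elem_sym n) (F + Poly_Mapping.single \<alpha> (Poly_Mapping.lookup c \<mu>))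
          = c' + const_mpol (Poly_Mapping.lookup c \<mu>) * E"
        using F by (simp add: ins_add[OF rhom_const] ins_single[OF rhom_const] E_def)
      also have "\<dots> = c" by (simp add: c'_def)
      finally show ?thesis by metis
    qed
  qed
qed

section \<open>The ideal of the polynomials \<open>f\<^sub>k\<close>\<close>

lemma rhom_map_poly:
  assumes "rhom h"
  shows "rhom (map_poly h)"
proof (rule rhomI)
  show "map_poly h 1 = 1" by (simp add: rhom_1[OF assms])
  show "map_poly h (f + g) = map_poly h f + map_poly h g" for f g
    by (rule poly_eqI) (simp add: coeff_map_poly rhom_0[OF assms] rhom_add[OF assms])
  show "map_poly h (f * g) = map_poly h f * map_poly h g" for f g
    by (rule poly_eqI) (simp add: coeff_map_poly coeff_mult rhom_0[OF assms] rhom_sum[OF assms] rhom_mult[OF assms])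
qed

lemma rhom_poly: "rhom (\<lambda>g. poly g a)"
  by (rule rhomI) auto

text \<open>Extends \<open>restr\<close> to the polynomial ring in t. The value
  \<open>- (var 0 ^ p)\<close> for t makes z^p - t equal to z^p + y^p, the factor contributed by the
  first p variables.\<close>

definition poly_restr :: "nat \<Rightarrow> 'a::comm_ring_1 mpol poly \<Rightarrow> 'a mpol" where
  "poly_restr p g = poly (map_poly (restr p) g) (- (var 0 ^ p))"

lemma rhom_poly_restr: "rhom (poly_restr p)"
  using rhom_comp[OF rhom_poly[of "- (var 0 ^ p)"] rhom_map_poly[OF rhom_restr[of p]]]
  by (simp add: poly_restr_def[abs_def] comp_def)

lemma poly_restr_pCons: "poly_restr p (pCons c g) = restr p c - var 0 ^ p * poly_restr p g"
  by (simp add: poly_restr_def map_poly_pCons rhom_0[OF rhom_restr])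

lemma poly_restr_0: "poly_restr p 0 = 0"
  by (rule rhom_0[OF rhom_poly_restr])

text \<open>For \<open>m \<le> n - p\<close> this is the coefficient of \<open>z\<^bsup>n-p-m\<^esup>\<close> in the quotient of \<open>\<Prod>\<^sub>i (z + x\<^sub>i)\<close> by
  \<open>z\<^sup>p - t\<close>; for \<open>n - p < m \<le> n\<close> it is one of the \<open>f\<^sub>k\<close>.\<close>

function quot_coeff :: "nat \<Rightarrow> nat \<Rightarrow> nat \<Rightarrow> 'a::comm_ring_1 mpol poly" where
  "quot_coeff n p m = (if p = 0 \<or> m < p then [:elem_sym n m:]
    else pCons (elem_sym n m) (quot_coeff n p (m - p)))"
  by pat_completeness auto
termination by (relation "measure (\<lambda>(n, p, m). m)") auto

declare quot_coeff.simps [simp del]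

lemma quot_coeff_less: "m < p \<Longrightarrow> quot_coeff n p m = [:elem_sym n m:]"
  by (subst quot_coeff.simps) simp

lemma quot_coeff_ge: "0 < p \<Longrightarrow> p \<le> m \<Longrightarrow>
    quot_coeff n p m = pCons (elem_sym n m) (quot_coeff n p (m - p))"
  by (subst quot_coeff.simps) simp

lemma pCons_0_sum: "pCons 0 (sum f A) = (\<Sum>a\<in>A. pCons 0 (f a))"
proof (induction A rule: infinite_finite_induct)
  case (insert a A)
  then show ?case using add_pCons[of 0 "f a" 0 "sum f A"] by simp
qed auto

lemma quot_coeff_eq_sum:
  assumes "k < p"
  shows "(quot_coeff n p (J * p + k) :: 'a::comm_ring_1 mpol poly)
    = (\<Sum>j\<le>J. monom (elem_sym n (j * p + k)) (J - j))"
proof (induction J)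
  case 0
  show ?case using assms by (simp add: quot_coeff_less monom_0)
next
  case (Suc J)
  have "(quot_coeff n p (Suc J * p + k) :: 'a mpol poly)
      = [:elem_sym n (Suc J * p + k):] + pCons 0 (quot_coeff n p (J * p + k))"
    using assms quot_coeff_ge[of p "Suc J * p + k" n] by simp
  also have "\<dots> = [:elem_sym n (Suc J * p + k):]
      + (\<Sum>j\<le>J. monom (elem_sym n (j * p + k)) (Suc J - j))"
    unfolding Suc.IH pCons_0_sum
    by (intro arg_cong2[where f = "(+)"] sum.cong refl) (simp add: Suc_diff_le monom_Suc)
  also have "\<dots> = (\<Sum>j\<le>Suc J. monom (elem_sym n (j * p + k)) (Suc J - j))"
    by (simp add: monom_0 add.commute)
  finally show ?case .
qed

lemma elem_sym_0: "elem_sym n 0 = 1"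
  by (simp add: elem_sym_eq_esym esym_0)

text \<open>The generator with number \<open>k\<close> is the quantity
  \<open>quot_coeff n p m\<close> for the largest \<open>m \<le> n\<close> congruent to
  \<open>k\<close> modulo p.\<close>

lemma fgen_eq_quot_coeff:
  assumes "0 < p" "p \<le> n" "k < p"
  shows "fgen n p k = quot_coeff n p ((if k \<le> n mod p then n div p else n div p - 1) * p + k)"
proof -
  obtain q where q: "n div p = Suc q"
    using assms by (metis div_greater_zero_iff gr0_implies_Suc)
  \<comment> \<open>For \<open>k = 0\<close> the leading coefficient 1 is the elementary symmetric
    polynomial of degree 0, which supplies the missing term \<open>j = 0\<close>.\<close>
  have "monom 1 (Suc q) + (\<Sum>j\<in>{1..Suc q}. monom (elem_sym n (j * p)) (Suc q - j))
      = (\<Sum>j\<in>insert 0 {1..Suc q}. monom (elem_sym n (j * p)) (Suc q - j))"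
    by (subst sum.insert) (auto simp: elem_sym_0)
  also have "insert 0 {1..Suc q} = {..Suc q}" by auto
  finally have "monom 1 (Suc q) + (\<Sum>j\<in>{1..Suc q}. monom (elem_sym n (j * p)) (Suc q - j))
      = (\<Sum>j\<le>Suc q. monom (elem_sym n (j * p)) (Suc q - j))" .
  then show ?thesis
    unfolding quot_coeff_eq_sum[OF assms(3)] fgen_def Let_def q
    by (cases "k = 0") (simp_all add: lessThan_Suc_atMost)
qed

lemma quot_index_bounds:
  fixes n p k :: nat
  assumes "0 < p" "p \<le> n" "k < p"
  defines "m \<equiv> (if k \<le> n mod p then n div p else n div p - 1) * p + k"
  shows "n - p < m" "m \<le> n"
proof -
  obtain q where q: "n div p = Suc q"
    using assms by (metis div_greater_zero_iff gr0_implies_Suc)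
  define r where "r = n mod p"
  have n: "n = q * p + p + r"
    using div_mult_mod_eq[of n p] by (simp add: q r_def algebra_simps)
  have r: "r < p" using assms(1) by (simp add: r_def)
  have m: "m = (if k \<le> r then q * p + p + k else q * p + k)"
    by (simp add: m_def q r_def algebra_simps)
  show "n - p < m" "m \<le> n"
    using n r assms(1,3) unfolding m by (cases "k \<le> r"; simp)+
qed

text \<open>The p consecutive integers from \<open>n - p + 1\<close> to \<open>n\<close> represent
  each residue once; their quotients by p are \<open>n div p\<close> or one less, depending on how
  the remainder compares with \<open>n mod p\<close>.\<close>

lemma quot_index_exists:
  fixes n p m :: nat
  assumes "0 < p" "p \<le> n" "n - p < m" "m \<le> n"
  shows "m = (if m mod p \<le> n mod p then n div p else n div p - 1) * p + m mod p"
proof -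
  obtain q where q: "n div p = Suc q"
    using assms by (metis div_greater_zero_iff gr0_implies_Suc)
  define r s d where "r = n mod p" and "s = m mod p" and "d = m div p"
  have n: "n = q * p + p + r" and m: "m = d * p + s"
    using div_mult_mod_eq[of n p] div_mult_mod_eq[of m p]
    by (simp_all add: q r_def s_def d_def algebra_simps)
  have r: "r < p" "s < p" using assms(1) by (simp_all add: r_def s_def)
  have "d \<le> Suc q" using div_le_mono[OF assms(4), of p] q by (simp add: d_def)
  moreover have "q * p < Suc d * p"
    using n m r assms(3) by simp
  then have "q \<le> d" by (simp only: mult_less_cancel2 less_Suc_eq_le)
  ultimately consider "d = q" | "d = Suc q" by linarith
  then have "m = (if s \<le> r then Suc q else q) * p + s"
  proof cases
    case 1
    then show ?thesis using n m assms(3) by simp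
  next
    case 2
    then show ?thesis using n m assms(4) by simp
  qed
  then show ?thesis by (simp only: q r_def s_def diff_Suc_1)
qed

text \<open>The ring of polynomials in t over the symmetric polynomials, as a subset of the
  type.\<close>

definition sym_poly_polys :: "nat \<Rightarrow> 'a::comm_ring_1 mpol poly set" where
  "sym_poly_polys n = {g. \<forall>i. coeff g i \<in> sym_polys n}"

lemma subring_sym_poly_polys: "subring (sym_poly_polys n)"
  unfolding subring_def sym_poly_polys_def
  using subring_sym_polys[of n]
  by (auto simp: coeff_mult subring_0 subring_1 subring_diff
      intro!: subring_sum subring_mult)

lemma pCons_in_sym_poly_polys:
  "c \<in> sym_polys n \<Longrightarrow> g \<in> sym_poly_polys n \<Longrightarrow> pCons c g \<in> sym_poly_polys n"
  by (auto simp: sym_poly_polys_def coeff_pCons split: nat.splits)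

lemma const_in_sym_poly_polys: "c \<in> sym_polys n \<Longrightarrow> [:c:] \<in> sym_poly_polys n"
  by (simp add: pCons_in_sym_poly_polys subring_0[OF subring_sym_poly_polys])

lemma quot_coeff_in_sym_poly_polys: "quot_coeff n p m \<in> sym_poly_polys n"
proof (induction n p m rule: quot_coeff.induct)
  case (1 n p m)
  then show ?case
    by (subst quot_coeff.simps)
      (auto intro: const_in_sym_poly_polys pCons_in_sym_poly_polys elem_sym_in_sym_polys)
qed

section \<open>Ideals over a subring and congruences\<close>

definition ideal_in :: "'b::comm_ring_1 set \<Rightarrow> 'b set \<Rightarrow> bool" where
  "ideal_in A J \<longleftrightarrow> 0 \<in> J \<and> (\<forall>x\<in>J. \<forall>y\<in>J. x + y \<in> J) \<and> (\<forall>a\<in>A. \<forall>x\<in>J. a * x \<in> J)"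

lemma ideal_in_0: "ideal_in A J \<Longrightarrow> 0 \<in> J"
  and ideal_in_add: "ideal_in A J \<Longrightarrow> x \<in> J \<Longrightarrow> y \<in> J \<Longrightarrow> x + y \<in> J"
  and ideal_in_mult: "ideal_in A J \<Longrightarrow> a \<in> A \<Longrightarrow> x \<in> J \<Longrightarrow> a * x \<in> J"
  by (simp_all add: ideal_in_def)

lemma ideal_in_sum: "ideal_in A J \<Longrightarrow> (\<And>i. i \<in> I \<Longrightarrow> f i \<in> J) \<Longrightarrow> sum f I \<in> J"
  by (induction I rule: infinite_finite_induct) (auto simp: ideal_in_0 ideal_in_add)

lemma ideal_in_mult_cong:
  assumes "subring A" "ideal_in A J" "x \<in> A" "y' \<in> A" "x - x' \<in> J" "y - y' \<in> J"
  shows "x * y - x' * y' \<in> J"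
proof -
  have "x * (y - y') + y' * (x - x') \<in> J"
    using assms by (intro ideal_in_add[OF assms(2)] ideal_in_mult[OF assms(2)])
  then show ?thesis by (simp add: algebra_simps)
qed

lemma ideal_in_power_cong:
  assumes "subring A" "ideal_in A J" "x \<in> A" "x' \<in> A" "x - x' \<in> J"
  shows "x ^ k - x' ^ k \<in> J"
proof (induction k)
  case 0
  then show ?case using ideal_in_0[OF assms(2)] by simp
next
  case (Suc k)
  then show ?case
    using ideal_in_mult_cong[OF assms(1-3) subring_power[OF assms(1,4), of k] assms(5)] by simp
qed

lemma ideal_in_prod_cong:
  assumes "subring A" "ideal_in A J" "\<And>i. i \<in> I \<Longrightarrow> u i \<in> A" "\<And>i. i \<in> I \<Longrightarrow> v i \<in> A"
    and "\<And>i. i \<in> I \<Longrightarrow> u i - v i \<in> J"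
  shows "prod u I - prod v I \<in> J"
  using assms(3-5)
proof (induction I rule: infinite_finite_induct)
  case (insert i I)
  then show ?case
    using ideal_in_mult_cong[OF assms(1,2), of "u i" "prod v I" "v i" "prod u I"]
      subring_prod[OF assms(1), of I v] by simp
qed (use ideal_in_0[OF assms(2)] in simp_all)

text \<open>Substituting congruent values gives congruent results, since congruence respects sums,
  products and powers within the subring.\<close>

lemma ideal_in_ins_cong:
  assumes "subring A" "ideal_in A J" "\<And>a. \<kappa> a \<in> A" "\<And>i. u i \<in> A" "\<And>i. v i \<in> A" "\<And>i. u i - v i \<in> J"
  shows "ins \<kappa> u F - ins \<kappa> v F \<in> J"
proof -
  have "mon_val u m - mon_val v m \<in> J" for m
    unfolding mon_val_def using assms
    by (intro ideal_in_prod_cong[OF assms(1,2)] ideal_in_power_cong[OF assms(1,2)] subring_power) auto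
  then have "(\<Sum>m\<in>Poly_Mapping.keys F. \<kappa> (Poly_Mapping.lookup F m) * (mon_val u m - mon_val v m)) \<in> J"
    using assms by (intro ideal_in_sum[OF assms(2)] ideal_in_mult[OF assms(2)])
  then show ?thesis by (simp add: ins_def algebra_simps sum_subtractf)
qed

definition fgen_ideal :: "nat \<Rightarrow> nat \<Rightarrow> 'a::comm_ring_1 mpol poly set" where
  "fgen_ideal n p = {\<Sum>k<p. g k * fgen n p k | g. \<forall>k<p. g k \<in> sym_poly_polys n}"

lemma ideal_in_fgen_ideal: "ideal_in (sym_poly_polys n) (fgen_ideal n p)"
  unfolding ideal_in_def
proof (intro conjI ballI)
  show "0 \<in> fgen_ideal n p"
    unfolding fgen_ideal_def
    by (intro CollectI exI[of _ "\<lambda>_. 0"]) (simp add: subring_0[OF subring_sym_poly_polys])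
  fix x y :: "'a mpol poly" assume "x \<in> fgen_ideal n p" "y \<in> fgen_ideal n p"
  then obtain g h where "x = (\<Sum>k<p. g k * fgen n p k)" "\<forall>k<p. g k \<in> sym_poly_polys n"
    "y = (\<Sum>k<p. h k * fgen n p k)" "\<forall>k<p. h k \<in> sym_poly_polys n"
    unfolding fgen_ideal_def by blast
  then show "x + y \<in> fgen_ideal n p"
    unfolding fgen_ideal_def
    by (intro CollectI exI[of _ "\<lambda>k. g k + h k"])
      (simp add: subring_add[OF subring_sym_poly_polys] distrib_right sum.distrib)
next
  fix a x :: "'a mpol poly" assume a: "a \<in> sym_poly_polys n" and "x \<in> fgen_ideal n p"
  then obtain g where "x = (\<Sum>k<p. g k * fgen n p k)" "\<forall>k<p. g k \<in> sym_poly_polys n"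
    unfolding fgen_ideal_def by blast
  then show "a * x \<in> fgen_ideal n p"
    unfolding fgen_ideal_def using a
    by (intro CollectI exI[of _ "\<lambda>k. a * g k"])
      (simp add: subring_mult[OF subring_sym_poly_polys] sum_distrib_left mult.assoc)
qed

lemma fgen_in_fgen_ideal:
  assumes "k < p"
  shows "fgen n p k \<in> fgen_ideal n p"
proof -
  have "fgen n p k = (\<Sum>j<p. (if j = k then 1 else 0) * fgen n p j)"
    using assms by (simp add: if_distrib[of "\<lambda>x. x * _"] cong: if_cong)
  then show ?thesis
    unfolding fgen_ideal_def
    by (intro CollectI exI[of _ "\<lambda>j. if j = k then 1 else 0"])
      (simp add: subring_0[OF subring_sym_poly_polys] subring_1[OF subring_sym_poly_polys])
qed

text \<open>Up to \<open>m = n\<close> these are the generators. Beyond \<open>n\<close> the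
  elementary symmetric polynomial vanishes, so the recursion only multiplies an earlier element,
  still of index above \<open>n - p\<close>, by t.\<close>

lemma quot_coeff_in_fgen_ideal:
  assumes "0 < p" "p \<le> n" "n - p < m"
  shows "(quot_coeff n p m :: 'a::comm_ring_1 mpol poly) \<in> fgen_ideal n p"
  using assms(3)
proof (induction m rule: less_induct)
  case (less m)
  show ?case
  proof (cases "m \<le> n")
    case True
    have "m mod p < p" using assms(1) by simp
    then show ?thesis
      using fgen_in_fgen_ideal[of "m mod p" p n] fgen_eq_quot_coeff[OF assms(1,2), of "m mod p"]
        quot_index_exists[OF assms(1,2) less.prems True] by metis
  next
    case False
    then have "elem_sym n m = (0 :: 'a mpol)" by (simp add: elem_sym_eq_esym esym_gt_card)
    then have "(quot_coeff n p m :: 'a mpol poly) = [:0, 1:] * quot_coeff n p (m - p)"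
      using quot_coeff_ge[of p m n, where ?'a = 'a] assms False by simp
    moreover have "([:0, 1:] :: 'a mpol poly) \<in> sym_poly_polys n"
      by (intro pCons_in_sym_poly_polys const_in_sym_poly_polys subring_0 subring_1 subring_sym_polys)
    moreover have "(quot_coeff n p (m - p) :: 'a mpol poly) \<in> fgen_ideal n p"
      using assms False by (intro less.IH) auto
    ultimately show ?thesis using ideal_in_mult[OF ideal_in_fgen_ideal] by metis
  qed
qed

section \<open>Images under the substitution in characteristic p\<close>

lemma CHAR_mpol: "CHAR('a::comm_ring_1 mpol) = CHAR('a)"
proof (rule CHAR_eqI)
  show "of_nat CHAR('a) = (0 :: 'a mpol)" by (rule of_nat_mpol_eq_0) simp
  fix k assume "of_nat k = (0 :: 'a mpol)"
  then have "Poly_Mapping.lookup (of_nat k :: 'a mpol) 0 = 0" by simp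
  then show "CHAR('a) dvd k" by (simp add: lookup_of_nat of_nat_eq_0_iff_char_dvd)
qed

lemma linear_power_CHAR:
  fixes y :: "'a::comm_ring_1 mpol"
  assumes "prime p" "CHAR('a) = p"
  shows "[:1, y:] ^ p = 1 + monom (y ^ p) p"
proof -
  have C: "CHAR('a mpol poly) = p" using assms(2) by (simp add: CHAR_mpol)
  have "[:1, y:] ^ p = (1 + monom y 1) ^ CHAR('a mpol poly)"
    unfolding C by (simp add: monom_altdef one_pCons)
  also have "\<dots> = 1 ^ CHAR('a mpol poly) + monom y 1 ^ CHAR('a mpol poly)"
    by (rule freshmans_dream) (use assms(1) C in \<open>simp_all only:\<close>)
  finally show ?thesis unfolding C by (simp add: monom_power)
qed

text \<open>The factors of the first p variables become (1 + y z)^p = 1 + y^p z^p. Compare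
  coefficients of z^m in the product with the remaining factors.\<close>

lemma restr_elem_sym:
  assumes "prime p" "CHAR('a::comm_ring_1) = p" "p \<le> n"
  shows "restr p (elem_sym n m :: 'a mpol) = esym var {p..<n} m
    + (if p \<le> m then var 0 ^ p * esym var {p..<n} (m - p) else 0)"
proof -
  let ?Q = "\<Prod>i\<in>{p..<n}. [:1, var i :: 'a mpol:]"
  have "{..<n} = {..<p} \<union> {p..<n}" using assms(3) by auto
  then have "(\<Prod>i<n. [:1, var (collapse p i) :: 'a mpol:])
      = (\<Prod>i<p. [:1, var (collapse p i):]) * (\<Prod>i\<in>{p..<n}. [:1, var (collapse p i):])"
    by (simp add: prod.union_disjoint ivl_disj_int)
  also have "(\<Prod>i<p. [:1, var (collapse p i) :: 'a mpol:]) = [:1, var 0:] ^ p"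
    by (simp add: collapse_def)
  also have "(\<Prod>i\<in>{p..<n}. [:1, var (collapse p i) :: 'a mpol:]) = ?Q"
    by (rule prod.cong) (auto simp: collapse_def)
  finally have "(\<Prod>i<n. [:1, var (collapse p i) :: 'a mpol:]) = ?Q + monom (var 0 ^ p) p * ?Q"
    by (simp add: linear_power_CHAR[OF assms(1,2)] distrib_right)
  then have "coeff (\<Prod>i<n. [:1, var (collapse p i) :: 'a mpol:]) m
      = coeff ?Q m + coeff (monom (var 0 ^ p) p * ?Q) m"
    by simp
  then show ?thesis
    unfolding elem_sym_eq_esym rhom_esym[OF rhom_restr] restr_var coeff_monom_mult
    by (simp add: coeff_prod_linear)
qed

text \<open>In the recursion, t times the earlier term contributes -y^p times an elementary
  symmetric polynomial in the remaining variables, which cancels the second summand of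
  \<open>restr_elem_sym\<close>.\<close>

lemma poly_restr_quot_coeff:
  assumes "prime p" "CHAR('a::comm_ring_1) = p" "p \<le> n"
  shows "poly_restr p (quot_coeff n p m :: 'a mpol poly) = esym var {p..<n} m"
proof (induction m rule: less_induct)
  case (less m)
  have p0: "0 < p" using assms(1) prime_gt_0_nat by blast
  show ?case
  proof (cases "m < p")
    case True
    then show ?thesis
      by (simp add: quot_coeff_less poly_restr_pCons poly_restr_0 restr_elem_sym[OF assms])
  next
    case False
    then show ?thesis
      using less.IH[of "m - p"] p0
      by (simp add: quot_coeff_ge poly_restr_pCons restr_elem_sym[OF assms])
  qed
qed

text \<open>The generators have indices above \<open>n - p\<close>, so they go to elementary
  symmetric polynomials of degree exceeding the number of remaining variables.\<close>

lemma poly_restr_fgen_ideal: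
  assumes "prime p" "CHAR('a::comm_ring_1) = p" "p \<le> n" "g \<in> (fgen_ideal n p :: 'a mpol poly set)"
  shows "poly_restr p g = 0"
proof -
  have p0: "0 < p" using assms(1) prime_gt_0_nat by blast
  have "poly_restr p (fgen n p k :: 'a mpol poly) = 0" if "k < p" for k
    using quot_index_bounds[OF p0 assms(3) that]
    by (simp only: fgen_eq_quot_coeff[OF p0 assms(3) that] poly_restr_quot_coeff[OF assms(1-3)])
      (rule esym_gt_card, auto)
  then show ?thesis
    using assms(4)
    by (auto simp: fgen_ideal_def rhom_sum[OF rhom_poly_restr] rhom_mult[OF rhom_poly_restr])
qed

section \<open>Algebraic independence and the kernel inside the ideal\<close>

text \<open>The exponent at 0 is p times the entry at 0, and the exponent at \<open>p + j\<close> is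
  the sum of the entries beyond \<open>j\<close>; differences of consecutive tail sums recover the
  rest.\<close>

lemma inj_mon_subst_shifted:
  assumes "0 < p"
  defines "L \<equiv> \<lambda>i. if i = 0 then Poly_Mapping.single 0 p else set_mon {p..<p + i}"
  shows "inj_on (mon_subst L) {\<alpha>. Poly_Mapping.keys \<alpha> \<subseteq> {..N}}"
proof (rule inj_onI)
  fix \<alpha> \<beta> assume "\<alpha> \<in> {\<alpha>. Poly_Mapping.keys \<alpha> \<subseteq> {..N}}" "\<beta> \<in> {\<alpha>. Poly_Mapping.keys \<alpha> \<subseteq> {..N}}"
    and eq: "mon_subst L \<alpha> = mon_subst L \<beta>"
  then have keys: "Poly_Mapping.keys \<alpha> \<subseteq> {..N}" "Poly_Mapping.keys \<beta> \<subseteq> {..N}" by auto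
  have at_0: "Poly_Mapping.lookup (mon_subst L \<gamma>) 0 = Poly_Mapping.lookup \<gamma> 0 * p"
    if "Poly_Mapping.keys \<gamma> \<subseteq> {..N}" for \<gamma>
  proof -
    have "Poly_Mapping.lookup (mon_subst L \<gamma>) 0
        = (\<Sum>i\<le>N. if i = 0 then Poly_Mapping.lookup \<gamma> i * p else 0)"
      unfolding lookup_mon_subst[OF finite_atMost that]
      by (intro sum.cong refl) (use assms(1) in \<open>simp add: L_def lookup_set_mon\<close>)
    then show ?thesis by simp
  qed
  have at_ge: "Poly_Mapping.lookup (mon_subst L \<gamma>) (p + j) = (\<Sum>i\<in>{Suc j..N}. Poly_Mapping.lookup \<gamma> i)"
    if "Poly_Mapping.keys \<gamma> \<subseteq> {..N}" for \<gamma> j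
  proof -
    have "Poly_Mapping.lookup (mon_subst L \<gamma>) (p + j)
        = (\<Sum>i\<le>N. if j < i then Poly_Mapping.lookup \<gamma> i else 0)"
      unfolding lookup_mon_subst[OF finite_atMost that]
      by (intro sum.cong refl) (use assms(1) in \<open>simp add: L_def lookup_set_mon lookup_single when_def\<close>)
    also have "\<dots> = (\<Sum>i\<in>{Suc j..N}. Poly_Mapping.lookup \<gamma> i)"
      by (rule sum.mono_neutral_cong_right) auto
    finally show ?thesis .
  qed
  show "\<alpha> = \<beta>"
  proof (rule poly_mapping_eqI)
    fix i
    consider "i = 0" | j where "i = Suc j" "i \<le> N" | "N < i" by (cases i) force+
    then show "Poly_Mapping.lookup \<alpha> i = Poly_Mapping.lookup \<beta> i"
    proof cases
      case 1
      then show ?thesis using at_0[OF keys(1)] at_0[OF keys(2)] eq assms(1) by simp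
    next
      case (2 j)
      have "(\<Sum>i\<in>{k..N}. Poly_Mapping.lookup \<alpha> i) = (\<Sum>i\<in>{k..N}. Poly_Mapping.lookup \<beta> i)" if "0 < k" for k
        using at_ge[OF keys(1), of "k - 1"] at_ge[OF keys(2), of "k - 1"] eq that by simp
      from this[of i] this[of "Suc i"] show ?thesis
        using 2 by (simp add: sum.atLeast_Suc_atMost)
    next
      case 3
      then have "i \<notin> Poly_Mapping.keys \<alpha>" "i \<notin> Poly_Mapping.keys \<beta>" using keys by auto
      then show ?thesis by (simp add: in_keys_iff)
    qed
  qed
qed

text \<open>Independence of y^p and the elementary symmetric polynomials of positive degree in the
  remaining variables. Slot 0 is free for y^p because the elementary polynomial of degree 0 is
  1.\<close>

lemma ins_esym_eq_0:
  fixes G :: "'a::comm_ring_1 mpol"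
  assumes "0 < p" "p \<le> n" "G \<in> polyring (Suc (n - p))"
    and "ins const_mpol (\<lambda>i. if i = 0 then var 0 ^ p else esym var {p..<n} i) G = 0"
  shows "G = 0"
proof (rule ins_eq_0_imp_eq_0[OF assms(4) _ _ inj_mon_subst_shifted[OF assms(1)]])
  show "Poly_Mapping.keys \<alpha> \<subseteq> {..n - p}" if "\<alpha> \<in> Poly_Mapping.keys G" for \<alpha>
    using assms(3) that by (auto simp: polyring_def lessThan_Suc_atMost)
  show "monic_lead (if i = 0 then var 0 ^ p else esym var {p..<n} i :: 'a mpol)
      (if i = 0 then Poly_Mapping.single 0 p else set_mon {p..<p + i})" if "i \<in> {..n - p}" for i
    using that monic_lead_single[of "Poly_Mapping.single 0 p"] monic_lead_esym[of i "n - p" p] assms(2)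
    by (cases "i = 0") (simp_all add: var_power)
qed

text \<open>Modulo the ideal, \<open>c\<close> equals a polynomial \<open>G\<close> in -t and the
  quotient coefficients. The extended substitution kills \<open>c\<close> and the ideal but sends
  the arguments of \<open>G\<close> to independent elements, so \<open>G = 0\<close>.\<close>

lemma kernel_restr_subset_fgen_ideal:
  fixes c :: "'a::comm_ring_1 mpol"
  assumes p: "prime p" "CHAR('a) = p" "p \<le> n"
    and c: "c \<in> sym_polys n" "restr p c = 0"
  shows "[:c:] \<in> fgen_ideal n p"
proof -
  have p0: "0 < p" using p(1) prime_gt_0_nat by blast
  let ?A = "sym_poly_polys n :: 'a mpol poly set" and ?J = "fgen_ideal n p :: 'a mpol poly set"
  note A = subring_sym_poly_polys[of n, where ?'a = 'a]
  note J = ideal_in_fgen_ideal[of n p, where ?'a = 'a]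
  let ?\<kappa> = "\<lambda>a :: 'a. [:const_mpol a:]"
  have \<kappa>: "rhom ?\<kappa>" using rhom_comp[OF rhom_pCons rhom_const] by (simp add: comp_def)
  obtain F where F: "c = ins const_mpol (elem_sym n) F"
    using sym_poly_in_elem_sym[OF c(1)] by blast
  \<comment> \<open>A formal model of the quotient coefficients: 1 in degree 0, free variables up to
    \<open>n - p\<close>, and 0 beyond, where the true ones lie in the ideal. This leaves
    \<open>var 0\<close> available for -t.\<close>
  define x where "x i = (if i = 0 then 1 else if i \<le> n - p then var i else 0 :: 'a mpol)" for i
  \<comment> \<open>Models multiplication of the quotient by z^p - t, which yields the elementary
    symmetric polynomials modulo the ideal.\<close>
  define e where "e i = x i + (if p \<le> i then var 0 * x (i - p) else 0)" for i
  define G where "G = ins const_mpol e F"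
  \<comment> \<open>Interprets the model: \<open>var 0\<close> becomes -t and the other variables
    become the actual quotient coefficients.\<close>
  define w :: "nat \<Rightarrow> 'a mpol poly" where "w i = (if i = 0 then [:0, -1:] else quot_coeff n p i)" for i
  define \<Psi> where "\<Psi> = ins ?\<kappa> w"
  have \<Psi>: "rhom \<Psi>" unfolding \<Psi>_def by (rule rhom_ins[OF \<kappa>])
  have \<Psi>_x: "\<Psi> (x i) = (if i \<le> n - p then quot_coeff n p i else 0)" for i
    using p0 by (auto simp: x_def rhom_0[OF \<Psi>] rhom_1[OF \<Psi>] w_def quot_coeff_less elem_sym_0 one_pCons)
      (simp_all add: \<Psi>_def ins_var[OF \<kappa>] w_def)
  have \<Psi>_e: "\<Psi> (e i) = \<Psi> (x i) + (if p \<le> i then [:0, -1:] * \<Psi> (x (i - p)) else 0)" for i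
    by (simp add: e_def rhom_add[OF \<Psi>] rhom_mult[OF \<Psi>] rhom_0[OF \<Psi>] del: mult_pCons_left)
      (simp add: \<Psi>_def ins_var[OF \<kappa>] w_def)
  have t: "[:0, -1:] \<in> ?A"
    by (intro pCons_in_sym_poly_polys const_in_sym_poly_polys subring_uminus subring_0 subring_1
        subring_sym_polys)
  have \<Psi>_x_A: "\<Psi> (x i) \<in> ?A" for i
    by (simp add: \<Psi>_x quot_coeff_in_sym_poly_polys subring_0[OF A])
  have \<Psi>_e_A: "\<Psi> (e i) \<in> ?A" for i
    unfolding \<Psi>_e using subring_mult[OF A t \<Psi>_x_A] subring_0[OF A]
    by (intro subring_add[OF A] \<Psi>_x_A) (simp split: if_split)
  have q_J: "quot_coeff n p i - \<Psi> (x i) \<in> ?J" for i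
    using quot_coeff_in_fgen_ideal[OF p0 p(3), of i] ideal_in_0[OF J]
    by (cases "i \<le> n - p") (simp_all add: \<Psi>_x)
  have e_J: "[:elem_sym n i:] - \<Psi> (e i) \<in> ?J" for i
  proof (cases "p \<le> i")
    case True
    have distrib: "a + s * b - (a' + s * b') = (a - a') + s * (b - b')" for a b a' b' s :: "'a mpol poly"
      by (simp add: algebra_simps)
    \<comment> \<open>The recursion of \<open>quot_coeff\<close> solved for the elementary symmetric
      polynomial.\<close>
    have "[:elem_sym n i:] = quot_coeff n p i + [:0, -1:] * (quot_coeff n p (i - p) :: 'a mpol poly)"
      by (simp add: quot_coeff_ge[OF p0 True])
    then have "[:elem_sym n i:] - \<Psi> (e i)
        = (quot_coeff n p i - \<Psi> (x i)) + [:0, -1:] * (quot_coeff n p (i - p) - \<Psi> (x (i - p)))"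
      using True by (simp only: \<Psi>_e distrib if_True)
    moreover have "(quot_coeff n p i - \<Psi> (x i)) + [:0, -1:] * (quot_coeff n p (i - p) - \<Psi> (x (i - p))) \<in> ?J"
      by (intro ideal_in_add[OF J] ideal_in_mult[OF J] q_J t)
    ultimately show ?thesis by simp
  next
    case False
    then show ?thesis using q_J[of i] by (simp add: \<Psi>_e quot_coeff_less)
  qed
  have "[:c:] = ins ?\<kappa> (\<lambda>i. [:elem_sym n i:]) F"
    unfolding F by (rule rhom_of_ins[OF rhom_pCons])
  moreover have "\<Psi> G = ins ?\<kappa> (\<lambda>i. \<Psi> (e i)) F"
    unfolding G_def rhom_of_ins[OF \<Psi>] by (simp add: \<Psi>_def ins_const[OF \<kappa>])
  moreover have "ins ?\<kappa> (\<lambda>i. [:elem_sym n i:]) F - ins ?\<kappa> (\<lambda>i. \<Psi> (e i)) F \<in> ?J"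
    by (rule ideal_in_ins_cong[OF A J])
      (intro const_in_sym_poly_polys const_in_sym_polys elem_sym_in_sym_polys e_J \<Psi>_e_A)+
  ultimately have cG: "[:c:] - \<Psi> G \<in> ?J" by simp
  have "poly_restr p ([:c:] - \<Psi> G) = 0"
    by (rule poly_restr_fgen_ideal[OF p cG])
  then have "poly_restr p (\<Psi> G) = 0"
    using c(2) by (simp add: rhom_diff[OF rhom_poly_restr] poly_restr_pCons poly_restr_0)
  moreover have "(\<lambda>a. poly_restr p (?\<kappa> a)) = const_mpol"
    by (simp add: fun_eq_iff poly_restr_pCons poly_restr_0 restr_const)
  \<comment> \<open>Applied after \<open>\<Psi>\<close>, the extended substitution maps the
    variables of the model to the independent family; -t becomes y^p.\<close>
  moreover have "(\<lambda>i. poly_restr p (w i)) = (\<lambda>i. if i = 0 then var 0 ^ p else esym var {p..<n} i)"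
    by (auto simp: fun_eq_iff w_def poly_restr_quot_coeff[OF p] poly_restr_pCons poly_restr_0
        rhom_0[OF rhom_restr] rhom_uminus[OF rhom_restr] rhom_1[OF rhom_restr])
  ultimately have "ins const_mpol (\<lambda>i. if i = 0 then var 0 ^ p else esym var {p..<n} i) G = 0"
    using rhom_of_ins[OF rhom_poly_restr, of p ?\<kappa> w G] by (simp add: \<Psi>_def)
  moreover have "G \<in> polyring (Suc (n - p))"
  proof -
    note P = subring_polyring[of "Suc (n - p)", where ?'a = 'a]
    have "x i \<in> polyring (Suc (n - p))" for i
      by (auto simp: x_def subring_0[OF P] subring_1[OF P] intro: var_in_polyring)
    then have "e i \<in> polyring (Suc (n - p))" for i
      by (auto simp: e_def subring_0[OF P] intro!: subring_add[OF P] subring_mult[OF P] var_in_polyring)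
    then show ?thesis
      unfolding G_def by (intro subring_ins[OF P] polyring_single) auto
  qed
  ultimately have "G = 0" using ins_esym_eq_0[OF p0 p(3)] by blast
  then show ?thesis using cG by (simp add: rhom_0[OF \<Psi>])
qed

section \<open>The field with p elements and the conclusion\<close>

text \<open>Translation by 1 permutes the field, so comparing the sums of all elements before and
  after gives p times 1 equal to 0.\<close>

lemma CHAR_of_card_prime:
  assumes "prime p" "card (UNIV :: 'a::field set) = p"
  shows "CHAR('a) = p"
proof -
  have fin: "finite (UNIV :: 'a set)"
    using assms prime_gt_0_nat[of p] by (intro card_ge_0_finite) simp
  have "(\<Sum>x\<in>UNIV. x + 1) = (\<Sum>x\<in>UNIV. x :: 'a)"
    by (rule sum.reindex_bij_witness[of _ "\<lambda>x. x - 1" "\<lambda>x. x + 1"]) auto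
  then have "of_nat p = (0::'a)"
    using assms(2) by (simp add: sum.distrib)
  then have "CHAR('a) dvd p"
    by (simp add: of_nat_eq_0_iff_char_dvd)
  then show ?thesis
    using assms(1) CHAR_not_1 by (auto simp: prime_nat_iff)
qed

text \<open>The field of p elements is any field type of that cardinality, and \<open>[:c:]\<close>
  is \<open>c\<close> viewed as a constant in t.\<close>

theorem theorem2p2:
  fixes n p :: nat
  assumes "0 < n" and "prime p" and "p \<le> n" and "card (UNIV :: 'a set) = p"
  shows "(transfer_image n :: 'a::field mpol set) =
    {c \<in> sym_polys n. \<exists>g :: nat \<Rightarrow> 'a mpol poly.
        (\<forall>k<p. \<forall>i. coeff (g k) i \<in> sym_polys n) \<and>
        [:c:] = (\<Sum>k<p. g k * fgen n p k)}"
proof -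
  note p = assms(2) CHAR_of_card_prime[OF assms(2,4)] assms(3)
  \<comment> \<open>On constants the extended substitution agrees with \<open>restr\<close>, so
    vanishing on the ideal gives the converse direction.\<close>
  have "restr p c = 0 \<longleftrightarrow> [:c:] \<in> fgen_ideal n p" if "c \<in> sym_polys n" for c :: "'a mpol"
    using kernel_restr_subset_fgen_ideal[OF p that] poly_restr_fgen_ideal[OF p, of "[:c:]"]
    by (auto simp: poly_restr_pCons poly_restr_0)
  moreover have "[:c:] \<in> fgen_ideal n p \<longleftrightarrow> (\<exists>g. (\<forall>k<p. \<forall>i. coeff (g k) i \<in> sym_polys n) \<and>
      [:c:] = (\<Sum>k<p. g k * fgen n p k))" for c :: "'a mpol"
    unfolding fgen_ideal_def sym_poly_polys_def mem_Collect_eq by blast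
  ultimately show ?thesis
    unfolding transfer_image_eq_kernel_restr[OF p] by blast
qed

end
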